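(* Let $0<c<\infty$ and let $r_2:\mathbb R^+\to\mathbb R$ be a function such that $n\mapsto c\sqrt n+r_2(n)$ is increasing (on $\mathbb R^+$) and $$\lim_{m\to\infty}\max\left\{|r_2(k)-r_2(m^2)|: m^2<k\le(m+1)^2\right\}=0,$$ where $m$ and $k$ are positive integers. Let $\varphi(n)=\exp(c\sqrt n+r_2(n))$ and $$S(\varphi):=\left\{x\in\mathbb I:\lim_{n\to\infty}\frac{S_n(x)}{\varphi(n)}=1\right\}.$$ Then $\dim_{\rm H}S(\varphi)=\frac12$.
   Context: $\mathbb R^+$ is the set of positive reals and $\mathbb I:=[0,1)\setminus\mathbb Q$. For $x\in\mathbb I$, $a_1(x),a_2(x),\dots$ are the coefficients (partial quotients, positive integers) of its continued fraction expansion $x=[a_1(x),a_2(x),\dots]=1/(a_1(x)+1/(a_2(x)+\cdots))$, and $S_n(x):=\sum_{k=1}^n a_k(x)$. $\dim_{\rm H}$ denotes Hausdorff dimension. *)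

theory Defs
  imports "HOL-Analysis.Analysis"
begin

section \<open>Hausdorff dimension\<close>

(* diam(U)^s with the conventions diam({})^s = 0 and diam(U)^0 = 1 for nonempty U; the case
   distinction is needed because 0 powr 0 = 0 in HOL. *)
definition diam_power :: "real \<Rightarrow> 'a::metric_space set \<Rightarrow> ennreal" where
  "diam_power s U = (if U = {} then 0 else if s = 0 then 1 else ennreal (diameter U powr s))"

(* Finite covers are included, since U n = {} is allowed and contributes 0.  Boundedness is
   required because the library's diameter is a real number and is unspecified for unbounded
   sets. *)
definition hausdorff_content :: "real \<Rightarrow> real \<Rightarrow> 'a::metric_space set \<Rightarrow> ennreal" where
  "hausdorff_content s \<delta> E =
     Inf {(\<Sum>n. diam_power s (U n)) | U :: nat \<Rightarrow> 'a set.
            E \<subseteq> (\<Union>n. U n) \<and> (\<forall>n. bounded (U n) \<and> diameter (U n) \<le> \<delta>)}"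

definition hausdorff_measure :: "real \<Rightarrow> 'a::metric_space set \<Rightarrow> ennreal" where
  "hausdorff_measure s E = (SUP \<delta>\<in>{0<..}. hausdorff_content s \<delta> E)"

definition hausdorff_dim :: "'a::metric_space set \<Rightarrow> ennreal" where
  "hausdorff_dim E = Inf {ennreal s | s. 0 \<le> s \<and> hausdorff_measure s E = 0}"


section \<open>Continued fractions\<close>

definition gauss_map :: "real \<Rightarrow> real" where
  "gauss_map x = frac (1 / x)"

(* The partial quotient a_k(x), for k >= 1; the value at k = 0 is junk.  For irrational x in
   (0,1) these are positive integers and x is the value of the corresponding infinite continued
   fraction: see cf_coeff_pos and cf_convergent_tendsto below. *)
definition cf_coeff :: "real \<Rightarrow> nat \<Rightarrow> nat" where
  "cf_coeff x k = nat \<lfloor>1 / (gauss_map ^^ (k - 1)) x\<rfloor>"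

definition cf_sum :: "real \<Rightarrow> nat \<Rightarrow> nat" where
  "cf_sum x n = (\<Sum>k=1..n. cf_coeff x k)"

definition unit_irrationals :: "real set" where
  "unit_irrationals = {0..<1} - \<rat>"

definition cf_sum_set :: "(real \<Rightarrow> real) \<Rightarrow> real set" where
  "cf_sum_set \<phi> =
     {x \<in> unit_irrationals. (\<lambda>n. real (cf_sum x n) / \<phi> (real n)) \<longlonglongrightarrow> 1}"

(* 1/(a_j + 1/(a_(j+1) + ... + 1/a_(j+n-1))) *)
fun finite_cf :: "(nat \<Rightarrow> nat) \<Rightarrow> nat \<Rightarrow> nat \<Rightarrow> real" where
  "finite_cf a j 0 = 0"
| "finite_cf a j (Suc n) = 1 / (real (a j) + finite_cf a (Suc j) n)"

lemma gauss_map_unit_irrationals: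
  assumes "x \<in> unit_irrationals"
  shows "gauss_map x \<in> unit_irrationals"
proof -
  have "1 / x \<notin> \<rat>"
    using assms Rats_inverse[of "1 / x"] by (auto simp: unit_irrationals_def inverse_eq_divide)
  moreover have "frac (1 / x) \<in> \<rat> \<longleftrightarrow> 1 / x \<in> \<rat>"
    by simp
  ultimately show ?thesis
    by (auto simp: unit_irrationals_def gauss_map_def frac_lt_1)
qed

lemma funpow_gauss_map_unit_irrationals:
  assumes "x \<in> unit_irrationals"
  shows "(gauss_map ^^ j) x \<in> unit_irrationals"
  by (induction j) (use assms gauss_map_unit_irrationals in auto)

lemma unit_irrationals_pos: "x \<in> unit_irrationals \<Longrightarrow> 0 < x"
  by (cases "x = 0") (auto simp: unit_irrationals_def)

lemma cf_coeff_pos: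
  assumes "x \<in> unit_irrationals"
  shows "cf_coeff x k \<ge> 1"
proof -
  define y where "y = (gauss_map ^^ (k - 1)) x"
  have "y \<in> unit_irrationals"
    using funpow_gauss_map_unit_irrationals[OF assms] by (simp add: y_def)
  then have "1 \<le> 1 / y"
    using unit_irrationals_pos[of y] by (auto simp: unit_irrationals_def)
  then have "1 \<le> \<lfloor>1 / y\<rfloor>"
    by linarith
  then show ?thesis
    unfolding cf_coeff_def y_def[symmetric] by linarith
qed

lemma gauss_map_step:
  assumes "x \<in> unit_irrationals"
  shows "(gauss_map ^^ j) x = 1 / (real (cf_coeff x (Suc j)) + (gauss_map ^^ Suc j) x)"
proof -
  define y where "y = (gauss_map ^^ j) x"
  have "y \<in> unit_irrationals"
    using funpow_gauss_map_unit_irrationals[OF assms] by (simp add: y_def)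
  then have "0 < y"
    by (rule unit_irrationals_pos)
  then have "real (nat \<lfloor>1 / y\<rfloor>) = of_int \<lfloor>1 / y\<rfloor>"
    by simp
  then have "real (cf_coeff x (Suc j)) + (gauss_map ^^ Suc j) x = 1 / y"
    by (simp add: cf_coeff_def gauss_map_def y_def[symmetric] frac_def)
  then show ?thesis
    by (simp add: y_def[symmetric])
qed

lemma finite_cf_bounds:
  assumes "\<And>k. a k \<ge> 1"
  shows "0 \<le> finite_cf a j n \<and> finite_cf a j n \<le> 1"
proof (induction n arbitrary: j)
  case (Suc n)
  have "real (a j) \<ge> 1"
    using assms[of j] by simp
  with Suc[of "Suc j"] show ?case
    by (auto simp: divide_simps)
qed auto

lemma two_step_contraction:
  fixes a b s t :: real
  assumes "a \<ge> 1" "b \<ge> 1" "s \<ge> 0" "t \<ge> 0"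
  shows "\<bar>1 / (a + 1 / (b + s)) - 1 / (a + 1 / (b + t))\<bar> \<le> \<bar>s - t\<bar> / 4"
proof -
  define p where "p = a * (b + s) + 1"
  define q where "q = a * (b + t) + 1"
  have "1 * 1 \<le> a * (b + s)" "1 * 1 \<le> a * (b + t)"
    using assms by (intro mult_mono; simp)+
  then have pq: "p \<ge> 2" "q \<ge> 2"
    by (simp_all add: p_def q_def)
  then have "2 * 2 \<le> p * q"
    by (intro mult_mono) auto
  have "b + s > 0" "b + t > 0"
    using assms by linarith+
  then have "1 / (a + 1 / (b + s)) = (b + s) / p" "1 / (a + 1 / (b + t)) = (b + t) / q"
    by (simp_all add: p_def q_def add_divide_eq_iff)
  moreover have "(b + s) / p - (b + t) / q = (s - t) / (p * q)"
  proof -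
    have "(b + s) * q - (b + t) * p = s - t"
      by (simp add: p_def q_def algebra_simps)
    then show ?thesis
      using pq by (simp add: diff_frac_eq)
  qed
  moreover have "\<bar>s - t\<bar> / (p * q) \<le> \<bar>s - t\<bar> / 4"
    using \<open>2 * 2 \<le> p * q\<close> by (intro divide_left_mono) auto
  ultimately show ?thesis
    using pq by (simp add: abs_mult)
qed

lemma finite_cf_error:
  assumes x: "x \<in> unit_irrationals"
  shows "\<bar>(gauss_map ^^ j) x - finite_cf (cf_coeff x) (Suc j) n\<bar> \<le> (1 / 4) ^ (n div 2)"
proof (induction n arbitrary: j rule: less_induct)
  case (less n)
  have in01: "0 \<le> (gauss_map ^^ i) x" "(gauss_map ^^ i) x \<le> 1" for i
    using funpow_gauss_map_unit_irrationals[OF x, of i] by (auto simp: unit_irrationals_def)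
  have cf01: "0 \<le> finite_cf (cf_coeff x) i m" "finite_cf (cf_coeff x) i m \<le> 1" for i m
    using finite_cf_bounds[OF cf_coeff_pos[OF x]] by auto
  show ?case
  proof (cases "n < 2")
    case True
    then show ?thesis
      using in01[of j] cf01[of "Suc j" n] by simp
  next
    case False
    then obtain m where n: "n = Suc (Suc m)"
      by (metis One_nat_def Suc_1 add_2_eq_Suc le_Suc_ex not_less)
    define a b where "a = real (cf_coeff x (Suc j))" and "b = real (cf_coeff x (Suc (Suc j)))"
    define s t where "s = (gauss_map ^^ Suc (Suc j)) x"
      and "t = finite_cf (cf_coeff x) (Suc (Suc (Suc j))) m"
    have "(gauss_map ^^ j) x = 1 / (a + 1 / (b + s))"
      using gauss_map_step[OF x, of j] gauss_map_step[OF x, of "Suc j"]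
      unfolding a_def b_def s_def by metis
    moreover have "finite_cf (cf_coeff x) (Suc j) n = 1 / (a + 1 / (b + t))"
      by (simp add: n a_def b_def t_def)
    moreover have "1 \<le> a" "1 \<le> b"
      using cf_coeff_pos[OF x, of "Suc j"] cf_coeff_pos[OF x, of "Suc (Suc j)"]
      by (simp_all add: a_def b_def)
    moreover have "0 \<le> s" "0 \<le> t"
      unfolding s_def t_def by (rule in01 cf01)+
    ultimately have "\<bar>(gauss_map ^^ j) x - finite_cf (cf_coeff x) (Suc j) n\<bar> \<le> \<bar>s - t\<bar> / 4"
      using two_step_contraction[of a b s t] by simp
    also have "\<dots> \<le> (1 / 4) ^ (m div 2) / 4"
      using less.IH[of m "Suc (Suc j)"] unfolding n s_def t_def by simp
    finally show ?thesis
      by (simp add: n)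
  qed
qed

lemma cf_convergent_tendsto:
  assumes "x \<in> unit_irrationals"
  shows "(\<lambda>n. finite_cf (cf_coeff x) 1 n) \<longlonglongrightarrow> x"
proof -
  have "filterlim (\<lambda>n::nat. n div 2) at_top sequentially"
    unfolding filterlim_at_top
  proof
    fix Z :: nat
    show "\<forall>\<^sub>F n in sequentially. Z \<le> n div 2"
      using eventually_ge_at_top[of "2 * Z"] by eventually_elim simp
  qed
  then have "(\<lambda>n. (1 / 4 :: real) ^ (n div 2)) \<longlonglongrightarrow> 0"
    by (rule filterlim_compose[rotated]) (rule LIMSEQ_power_zero, simp)
  moreover have "\<forall>n. norm (finite_cf (cf_coeff x) 1 n - x) \<le> (1 / 4) ^ (n div 2)"
    using finite_cf_error[OF assms, of 0] by (simp add: abs_minus_commute)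
  ultimately have "(\<lambda>n. finite_cf (cf_coeff x) 1 n - x) \<longlonglongrightarrow> 0"
    by (rule Lim_null_comparison[OF always_eventually, rotated])
  then show ?thesis
    by (rule LIM_zero_cancel)
qed

end

theory Submission
  imports Defs "HOL-Probability.Infinite_Product_Measure" "HOL-Real_Asymp.Real_Asymp"
    "HOL-Library.Discrete_Functions"
begin

text \<open>
  Write \<open>\<phi> n = exp (L n)\<close> with \<open>L n = c * sqrt n + r n\<close>.  Between consecutive squares the perturbation
  \<open>r\<close> is nearly constant, so \<open>L\<close> grows by about \<open>c\<close> across \<open>{m\<^sup>2..(m + 1)\<^sup>2}\<close> and by about \<open>c / q\<close>
  across each of \<open>q\<close> pieces on which \<open>sqrt\<close> grows by \<open>1 / q\<close>.

  Dimension at most one half.  If \<open>S\<^sub>n / \<phi> n\<close> tends to \<open>1\<close>, then \<open>S\<close> has to grow by a fixed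
  proportion of \<open>\<phi>\<close> over every such piece; the piece has only about \<open>2 m / q\<close> indices, hence it contains
  a digit exceeding \<open>exp (\<kappa> m)\<close> for a constant \<open>\<kappa> > 0\<close> that does not depend on \<open>q\<close>.
  Let \<open>s > 1 / 2\<close>.  The inverse branch \<open>t \<mapsto> 1 / (a + t)\<close> of the Gauss map contracts by \<open>a\<^sup>-\<^sup>2\<close>, so a free digit multiplies the \<open>s\<close>-dimensional
  Hausdorff content by at most \<open>Z = (\<Sum>a. a powr - (s + 1 / 2))\<close>, whereas a digit known to be at least
  \<open>M\<close> gains the extra factor \<open>M powr - (s - 1 / 2)\<close>.  A piece therefore costs
  \<open>exp (O(m / q))\<close> and gains \<open>exp (- \<kappa>' m)\<close> with \<open>\<kappa>' > 0\<close> independent of \<open>q\<close>; for large \<open>q\<close>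
  the content is halved at every piece, and so it vanishes
  (\<open>hausdorff_measure_zero_of_large_digit_blocks\<close>, \<open>eventually_large_digit\<close>).

  Dimension at least one half.  Let the \<open>k\<close>-th digit be \<open>\<phi> k - \<phi> (k - 1)\<close> up to an error that ranges
  freely over about \<open>\<phi> k / k\<^sup>2\<close> values.  The errors add up to \<open>o(\<phi> n)\<close>, so all these points belong to
  the set.  In the resulting Cantor set a digit has about \<open>\<phi> k\<close> choices and shrinks lengths by about
  \<open>\<phi> k powr - 2\<close>, up to factors polynomial in \<open>k\<close>.  Since \<open>\<phi> k\<close> grows faster than any polynomial
  and \<open>\<phi> (k + 1) / \<phi> k\<close> is bounded, the mass distribution principle gives positive
  \<open>s\<close>-dimensional measure for every \<open>s < 1 / 2\<close>
  (\<open>hausdorff_measure_digit_cantor_set_nonzero\<close>, \<open>hausdorff_measure_cf_sum_nonzero\<close>).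
\<close>

section \<open>Continued fractions with prescribed partial quotients\<close>

lemma cf_coeff_funpow_gauss_map:
  assumes "k \<ge> 1"
  shows "cf_coeff ((gauss_map ^^ j) x) k = cf_coeff x (j + k)"
proof -
  have "k - 1 + j = j + k - 1"
    using assms by simp
  then show ?thesis
    by (simp add: cf_coeff_def flip: funpow_add[THEN fun_cong, unfolded o_apply])
qed

lemma cf_sum_eq: "cf_sum x n = (\<Sum>k<n. cf_coeff x (Suc k))"
  unfolding cf_sum_def by (rule sum.reindex_bij_witness[of _ Suc "\<lambda>k. k - 1"]) auto

lemma unit_irrationals_eq:
  assumes "x \<in> unit_irrationals"
  shows "x = 1 / (real (cf_coeff x 1) + gauss_map x)"
  using gauss_map_step[OF assms, of 0] by simp

lemma inverse_shift_diff:
  fixes a b s t :: real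
  assumes "a + s \<noteq> 0" "b + t \<noteq> 0"
  shows "1 / (a + s) - 1 / (b + t) = ((b + t) - (a + s)) / ((a + s) * (b + t))"
  using assms by (simp add: field_simps)

text \<open>Two further levels of the continued fraction contract by \<open>1 / 4\<close>, whatever the tails are.\<close>

lemma finite_cf_Cauchy:
  assumes "\<And>k. a k \<ge> 1"
  shows "\<bar>finite_cf a j (n + m) - finite_cf a j n\<bar> \<le> (1 / 4) ^ (n div 2)"
proof (induction n arbitrary: j rule: less_induct)
  case (less n)
  note cf01 = finite_cf_bounds[of a, OF assms]
  show ?case
  proof (cases "n < 2")
    case True
    then show ?thesis
      using cf01[of j "n + m"] cf01[of j n] by (simp add: abs_le_iff)
  next
    case False
    then obtain n' where n: "n = Suc (Suc n')"
      by (metis One_nat_def Suc_1 add_2_eq_Suc le_Suc_ex not_less)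
    let ?s = "finite_cf a (Suc (Suc j)) (n' + m)" and ?t = "finite_cf a (Suc (Suc j)) n'"
    have "\<bar>finite_cf a j (n + m) - finite_cf a j n\<bar> \<le> \<bar>?s - ?t\<bar> / 4"
      using two_step_contraction[of "a j" "a (Suc j)" ?s ?t] assms[of j] assms[of "Suc j"]
        cf01[of "Suc (Suc j)"] by (simp add: n)
    also have "\<dots> \<le> (1 / 4) ^ (n' div 2) / 4"
      using less.IH[of n' "Suc (Suc j)"] by (simp add: n)
    finally show ?thesis
      by (simp add: n)
  qed
qed

lemma finite_cf_convergent:
  assumes "\<And>k. a k \<ge> 1"
  shows "convergent (finite_cf a j)"
proof -
  have "Cauchy (finite_cf a j)"
  proof (rule CauchyI)
    fix e :: real
    assume "e > 0"
    then obtain N where N: "(1 / 4 :: real) ^ N < e / 2"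
      using real_arch_pow_inv[of "e / 2" "1 / 4"] by auto
    show "\<exists>M. \<forall>m\<ge>M. \<forall>n\<ge>M. norm (finite_cf a j m - finite_cf a j n) < e"
    proof (intro exI allI impI)
      fix m n
      assume "2 * N \<le> m" "2 * N \<le> n"
      then obtain m' n' where "m = 2 * N + m'" "n = 2 * N + n'"
        by (auto simp: le_iff_add)
      then show "norm (finite_cf a j m - finite_cf a j n) < e"
        using finite_cf_Cauchy[of a j "2 * N" m'] finite_cf_Cauchy[of a j "2 * N" n'] N assms
        by auto
    qed
  qed
  then show ?thesis
    by (rule Cauchy_convergent)
qed

text \<open>
  The Gauss map strictly decreases the denominator of a rational number, so an orbit that stays
  in \<open>(0, 1)\<close> forever cannot start at a rational.
\<close>

lemma infinite_cf_irrational: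
  fixes v :: "nat \<Rightarrow> real" and a :: "nat \<Rightarrow> nat"
  assumes v01: "\<And>j. 0 < v j \<and> v j < 1" and step: "\<And>j. v j = 1 / (real (a j) + v (Suc j))"
  shows "v j \<notin> \<rat>"
proof -
  have "v j \<noteq> real p / real q" for p q
  proof (induction q arbitrary: j p rule: less_induct)
    case (less q)
    show ?case
    proof
      assume eq: "v j = real p / real q"
      then have pq: "0 < p" "p < q"
      proof -
        have "q > 0"
          using eq v01[of j] by (cases "q = 0") auto
        then have p: "real p = v j * real q"
          by (simp add: eq)
        then show "0 < p"
          using v01[of j] \<open>q > 0\<close> by (metis mult_pos_pos of_nat_0_less_iff)
        show "p < q"
        proof -
          have "v j * real q < 1 * real q"
            using v01[of j] \<open>q > 0\<close> by (intro mult_strict_right_mono) auto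
          then show ?thesis
            by (simp flip: p)
        qed
      qed
      have "real (a j) + v (Suc j) = real q / real p"
        using step[of j] eq pq v01[of "Suc j"] by (auto simp: field_simps)
      then have v: "v (Suc j) = (real q - real (a j * p)) / real p"
        using pq by (simp add: field_simps)
      then have "a j * p \<le> q"
        using v01[of "Suc j"] pq by (auto simp: zero_less_divide_iff simp flip: of_nat_mult)
      then have "v (Suc j) = real (q - a j * p) / real p"
        using v by (simp add: of_nat_diff)
      with less pq show False
        by blast
    qed
  qed
  moreover have "\<exists>p q. v j = real p / real q" if "v j \<in> \<rat>"
    using Rats_abs_nat_div_natE[OF that] v01[of j] by (metis abs_of_pos)
  ultimately show ?thesis
    by blast
qed

lemma ex_unit_irrational_cf_coeff:
  fixes a :: "nat \<Rightarrow> nat"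
  assumes a: "\<And>k. a k \<ge> 1"
  shows "\<exists>x \<in> unit_irrationals. \<forall>k. cf_coeff x (Suc k) = a k"
proof -
  define v where "v j = lim (finite_cf a j)" for j
  have lim: "finite_cf a j \<longlonglongrightarrow> v j" for j
    using finite_cf_convergent[of a j, OF a] by (simp add: v_def convergent_LIMSEQ_iff)
  have nonneg: "0 \<le> v j" for j
    using finite_cf_bounds[of a, OF a] by (intro LIMSEQ_le_const[OF lim]) auto
  have pos: "0 < real (a j) + v (Suc j)" for j
    using a[of j] nonneg[of "Suc j"] by simp
  have step: "v j = 1 / (real (a j) + v (Suc j))" for j
  proof (rule LIMSEQ_unique)
    show "(\<lambda>n. finite_cf a j (Suc n)) \<longlonglongrightarrow> v j"
      by (rule LIMSEQ_Suc[OF lim])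
    show "(\<lambda>n. finite_cf a j (Suc n)) \<longlonglongrightarrow> 1 / (real (a j) + v (Suc j))"
      using pos[of j] by (auto intro!: tendsto_intros lim)
  qed
  have vpos: "0 < v j" for j
    using pos[of j] step[of j] by (metis zero_less_divide_1_iff)
  have v01: "0 < v j \<and> v j < 1" for j
  proof -
    have "1 < real (a j) + v (Suc j)"
      using vpos[of "Suc j"] a[of j] by simp
    then have "1 / (real (a j) + v (Suc j)) < 1"
      by simp
    with vpos[of j] show ?thesis
      unfolding step[of j, symmetric] by simp
  qed
  have inv: "1 / v j = real (a j) + v (Suc j)" for j
    using step[of j] pos[of j] by simp
  have floor: "\<lfloor>1 / v j\<rfloor> = int (a j)" for j
    using v01[of "Suc j"] by (simp add: inv floor_eq_iff)
  have gauss: "gauss_map (v j) = v (Suc j)" for j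
    using floor[of j] inv[of j] by (simp add: gauss_map_def frac_def)
  have "(gauss_map ^^ j) (v 0) = v j" for j
    by (induction j) (simp_all add: gauss)
  then have "cf_coeff (v 0) (Suc k) = a k" for k
    using floor[of k] by (simp add: cf_coeff_def)
  moreover have "v 0 \<in> unit_irrationals"
    using infinite_cf_irrational[where v = v and a = a and j = 0, OF v01 step] v01[of 0]
    by (simp add: unit_irrationals_def)
  ultimately show ?thesis
    by blast
qed

text \<open>
  Partial quotients at least \<open>2\<close> confine the tails to \<open>(0, 1 / 2)\<close>, so cylinders with different
  first digits \<open>a \<noteq> b\<close> are a distance of order \<open>1 / (a b)\<close> apart.  A common first digit
  \<open>a\<close> contracts distances by a factor no smaller than \<open>1 / (a + 1)\<^sup>2\<close>.
\<close>

lemma cf_separation: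
  fixes A :: "nat \<Rightarrow> nat"
  assumes "x \<in> unit_irrationals" "y \<in> unit_irrationals"
    and "\<And>k. 2 \<le> cf_coeff x (Suc k) \<and> cf_coeff x (Suc k) < A k"
    and "\<And>k. 2 \<le> cf_coeff y (Suc k) \<and> cf_coeff y (Suc k) < A k"
    and "\<exists>k<n. cf_coeff x (Suc k) \<noteq> cf_coeff y (Suc k)"
  shows "(\<Prod>k<n. 1 / real (A k) ^ 2) / 2 \<le> \<bar>x - y\<bar>"
  using assms
proof (induction n arbitrary: x y A)
  case 0
  then show ?case by simp
next
  case (Suc n)
  define a b where "a = real (cf_coeff x 1)" and "b = real (cf_coeff y 1)"
  define s t where "s = gauss_map x" and "t = gauss_map y"
  have half: "0 < gauss_map z \<and> gauss_map z < 1 / 2"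
    if z: "z \<in> unit_irrationals" "\<And>k. 2 \<le> cf_coeff z (Suc k)" for z
  proof -
    have irr: "gauss_map z \<in> unit_irrationals" "gauss_map (gauss_map z) \<in> unit_irrationals"
      using z(1) gauss_map_unit_irrationals by auto
    have "gauss_map z = 1 / (real (cf_coeff z 2) + gauss_map (gauss_map z))"
      using gauss_map_step[OF z(1), of 1] by (simp add: numeral_2_eq_2)
    moreover have "real (cf_coeff z 2) \<ge> 2"
      using z(2)[of 1] by (simp add: numeral_2_eq_2)
    ultimately show ?thesis
      using unit_irrationals_pos[OF irr(1)] unit_irrationals_pos[OF irr(2)]
        frac_less2[of 1 1 2 "real (cf_coeff z 2) + gauss_map (gauss_map z)"] by auto
  qed
  have st: "0 < s" "s < 1 / 2" "0 < t" "t < 1 / 2"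
    using half Suc.prems by (auto simp: s_def t_def)
  have ab: "2 \<le> a" "a + 1 \<le> A 0" "2 \<le> b" "b + 1 \<le> A 0"
    using Suc.prems(3,4)[of 0] by (auto simp: a_def b_def)
  have xy: "x = 1 / (a + s)" "y = 1 / (b + t)"
    using unit_irrationals_eq[OF Suc.prems(1)] unit_irrationals_eq[OF Suc.prems(2)]
    by (auto simp: a_def b_def s_def t_def)
  have "x - y = ((b + t) - (a + s)) / ((a + s) * (b + t))"
    unfolding xy using ab st by (intro inverse_shift_diff) auto
  then have diff: "\<bar>x - y\<bar> = \<bar>(b + t) - (a + s)\<bar> / ((a + s) * (b + t))"
    using ab st by (simp add: abs_mult)
  have den: "(a + s) * (b + t) \<le> real (A 0) ^ 2" "0 < (a + s) * (b + t)"
    using ab st by (auto simp: power2_eq_square intro!: mult_mono)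
  have lower: "d * (1 / real (A 0) ^ 2) \<le> \<bar>x - y\<bar>" if "0 \<le> d" "d \<le> \<bar>(b + t) - (a + s)\<bar>" for d
    unfolding diff using that den by (simp add: frac_le)
  have A: "A k \<ge> 1" for k
    using Suc.prems(3)[of k] by simp
  have prod_le: "(\<Prod>k<n. 1 / real (A (Suc k)) ^ 2) \<le> 1"
    using A by (intro prod_le_1) (auto simp: divide_simps)
  have split: "(\<Prod>k<Suc n. 1 / real (A k) ^ 2) / 2
      = ((\<Prod>k<n. 1 / real (A (Suc k)) ^ 2) / 2) * (1 / real (A 0) ^ 2)"
    by (subst prod.lessThan_Suc_shift) simp
  show ?case
    unfolding split
  proof (rule lower)
    show "0 \<le> (\<Prod>k<n. 1 / real (A (Suc k)) ^ 2) / 2"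
      by (intro divide_nonneg_nonneg prod_nonneg) auto
    show "(\<Prod>k<n. 1 / real (A (Suc k)) ^ 2) / 2 \<le> \<bar>(b + t) - (a + s)\<bar>"
    proof (cases "cf_coeff x 1 = cf_coeff y 1")
      case True
      have shift: "cf_coeff (gauss_map z) (Suc k) = cf_coeff z (Suc (Suc k))" for z k
        using cf_coeff_funpow_gauss_map[of "Suc k" 1 z] by simp
      have "\<exists>k<n. cf_coeff x (Suc (Suc k)) \<noteq> cf_coeff y (Suc (Suc k))"
        using Suc.prems(5) True by (metis One_nat_def less_Suc_eq_0_disj)
      then have "(\<Prod>k<n. 1 / real (A (Suc k)) ^ 2) / 2 \<le> \<bar>s - t\<bar>"
        unfolding s_def t_def using Suc.prems(1-4)
        by (intro Suc.IH[of _ _ "\<lambda>k. A (Suc k)"])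
          (auto simp: shift intro: gauss_map_unit_irrationals)
      with True show ?thesis
        by (simp add: a_def b_def abs_minus_commute)
    next
      case False
      then have "\<bar>b - a\<bar> \<ge> 1"
        by (auto simp: a_def b_def)
      with st prod_le show ?thesis
        by linarith
    qed
  qed
qed

section \<open>Hausdorff content\<close>

lemma hausdorff_content_le_cover:
  assumes "E \<subseteq> (\<Union>n. U n)" "\<And>n. bounded (U n) \<and> diameter (U n) \<le> \<delta>"
  shows "hausdorff_content s \<delta> E \<le> (\<Sum>n. diam_power s (U n))"
  unfolding hausdorff_content_def by (rule Inf_lower) (use assms in blast)

lemma hausdorff_content_mono: "E \<subseteq> F \<Longrightarrow> hausdorff_content s \<delta> E \<le> hausdorff_content s \<delta> F"
  unfolding hausdorff_content_def by (rule Inf_superset_mono) blast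

lemma hausdorff_content_empty:
  assumes "0 \<le> \<delta>"
  shows "hausdorff_content s \<delta> {} = 0"
  using hausdorff_content_le_cover[of "{}" "\<lambda>_. {}" \<delta> s] assms by (simp add: diam_power_def)

lemma hausdorff_content_near_cover:
  assumes "hausdorff_content s \<delta> E < b"
  obtains U where "E \<subseteq> (\<Union>n. U n)" "\<And>n. bounded (U n) \<and> diameter (U n) \<le> \<delta>"
    "(\<Sum>n. diam_power s (U n)) < b"
  using assms unfolding hausdorff_content_def Inf_less_iff by blast

text \<open>Covers that are optimal up to \<open>e / 2 ^ (i + 1)\<close> for \<open>E i\<close> are merged into one sequence.\<close>

lemma hausdorff_content_countable_UN:
  "hausdorff_content s \<delta> (\<Union>i::nat. E i) \<le> (\<Sum>i. hausdorff_content s \<delta> (E i))"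
proof (rule ennreal_le_epsilon)
  fix e :: real
  assume fin: "(\<Sum>i. hausdorff_content s \<delta> (E i)) < top" and e: "0 < e"
  have "\<exists>U. E i \<subseteq> (\<Union>n. U n) \<and> (\<forall>n. bounded (U n) \<and> diameter (U n) \<le> \<delta>) \<and>
      (\<Sum>n. diam_power s (U n)) \<le> hausdorff_content s \<delta> (E i) + ennreal (e * (1 / 2) ^ Suc i)" for i
  proof -
    have "hausdorff_content s \<delta> (E i) < top"
      using fin ennreal_suminf_lessD by blast
    moreover have "0 < ennreal (e * (1 / 2) ^ Suc i)"
      using e by simp
    ultimately have "hausdorff_content s \<delta> (E i)
        < hausdorff_content s \<delta> (E i) + ennreal (e * (1 / 2) ^ Suc i)"
      by (metis add.right_neutral ennreal_add_left_cancel_less infinity_ennreal_def order_less_irrefl)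
    then show ?thesis
      by (rule hausdorff_content_near_cover) (auto intro: less_imp_le)
  qed
  then obtain U where U: "\<And>i. E i \<subseteq> (\<Union>n. U i n)"
      "\<And>i n. bounded (U i n) \<and> diameter (U i n) \<le> \<delta>"
      "\<And>i. (\<Sum>n. diam_power s (U i n)) \<le> hausdorff_content s \<delta> (E i) + ennreal (e * (1 / 2) ^ Suc i)"
    by metis
  define V where "V k = case_prod U (prod_decode k)" for k
  have "hausdorff_content s \<delta> (\<Union>i. E i) \<le> (\<Sum>k. diam_power s (V k))"
  proof (rule hausdorff_content_le_cover)
    show "(\<Union>i. E i) \<subseteq> (\<Union>k. V k)"
    proof
      fix x
      assume "x \<in> (\<Union>i. E i)"
      then obtain i n where "x \<in> U i n"
        using U(1) by blast
      then have "x \<in> V (prod_encode (i, n))"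
        by (simp add: V_def)
      then show "x \<in> (\<Union>k. V k)"
        by blast
    qed
    show "bounded (V k) \<and> diameter (V k) \<le> \<delta>" for k
      using U(2) by (simp add: V_def split: prod.split)
  qed
  also have "\<dots> = (\<Sum>i. \<Sum>n. diam_power s (U i n))"
    using suminf_ennreal_2dimen[of "\<lambda>i. \<Sum>n. diam_power s (U i n)" "\<lambda>(i, n). diam_power s (U i n)"]
    by (simp add: V_def case_prod_beta)
  also have "\<dots> \<le> (\<Sum>i. hausdorff_content s \<delta> (E i) + ennreal (e * (1 / 2) ^ Suc i))"
    by (intro suminf_le U(3)) auto
  also have "\<dots> = (\<Sum>i. hausdorff_content s \<delta> (E i)) + (\<Sum>i. ennreal (e * (1 / 2) ^ Suc i))"
    by (intro suminf_add[symmetric]) auto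
  also have "(\<Sum>i. ennreal (e * (1 / 2) ^ Suc i)) = ennreal e"
  proof -
    have "(\<lambda>i. e * (1 / 2) ^ Suc i) sums (e * 1)"
      by (intro sums_mult power_half_series)
    then show ?thesis
      using e by (intro suminf_ennreal_eq) auto
  qed
  finally show "hausdorff_content s \<delta> (\<Union>i. E i) \<le> (\<Sum>i. hausdorff_content s \<delta> (E i)) + ennreal e" .
qed

lemma hausdorff_content_finite_UN:
  fixes n :: nat
  assumes "0 \<le> \<delta>"
  shows "hausdorff_content s \<delta> (\<Union>i<n. E i) \<le> (\<Sum>i<n. hausdorff_content s \<delta> (E i))"
proof -
  let ?F = "\<lambda>i. if i < n then E i else {}"
  have "(\<Union>i<n. E i) = (\<Union>i. ?F i)"
    by auto
  then have "hausdorff_content s \<delta> (\<Union>i<n. E i) \<le> (\<Sum>i. hausdorff_content s \<delta> (?F i))"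
    using hausdorff_content_countable_UN[of s \<delta> ?F] by (simp only:)
  also have "\<dots> = (\<Sum>i<n. hausdorff_content s \<delta> (?F i))"
    using assms by (intro suminf_finite) (auto simp: hausdorff_content_empty)
  finally show ?thesis
    by simp
qed

lemma hausdorff_content_lipschitz_image:
  fixes f :: "'a::metric_space \<Rightarrow> 'b::real_normed_vector"
  assumes lip: "\<And>x y. x \<in> Q \<Longrightarrow> y \<in> Q \<Longrightarrow> dist (f x) (f y) \<le> K * dist x y"
    and K: "0 < K" "K \<le> 1" and s: "0 < s"
  shows "hausdorff_content s \<delta> (f ` Q) \<le> ennreal (K powr s) * hausdorff_content s \<delta> Q"
proof -
  have "ennreal (K powr - s) * hausdorff_content s \<delta> (f ` Q) \<le> hausdorff_content s \<delta> Q"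
    unfolding hausdorff_content_def[of s \<delta> Q]
  proof (rule Inf_greatest, clarify)
    fix U :: "nat \<Rightarrow> 'a set"
    assume cover: "Q \<subseteq> (\<Union>n. U n)" and U: "\<forall>n. bounded (U n) \<and> diameter (U n) \<le> \<delta>"
    define V where "V n = f ` (U n \<inter> Q)" for n
    have dV: "norm (u - v) \<le> K * diameter (U n)" if uv: "u \<in> V n" "v \<in> V n" for u v n
    proof -
      obtain x y where xy: "x \<in> U n" "x \<in> Q" "y \<in> U n" "y \<in> Q" "u = f x" "v = f y"
        using uv by (auto simp: V_def)
      then have "norm (u - v) \<le> K * dist x y"
        using lip by (simp flip: dist_norm)
      also have "\<dots> \<le> K * diameter (U n)"
        using xy U K by (intro mult_left_mono diameter_bounded_bound) auto
      finally show ?thesis .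
    qed
    have dU: "0 \<le> diameter (U n)" for n
      using U by (simp add: diameter_ge_0)
    have diam: "diameter (V n) \<le> K * diameter (U n)" for n
      using dV K dU by (intro diameter_le) auto
    have bdd: "bounded (V n)" for n
      unfolding bounded_two_points using dV by (auto simp: dist_norm)
    have "hausdorff_content s \<delta> (f ` Q) \<le> (\<Sum>n. diam_power s (V n))"
    proof (rule hausdorff_content_le_cover)
      show "f ` Q \<subseteq> (\<Union>n. V n)"
        using cover by (force simp: V_def)
      show "bounded (V n) \<and> diameter (V n) \<le> \<delta>" for n
        using bdd diam[of n] U dU[of n] K mult_left_le_one_le[of "diameter (U n)" K]
        by (meson less_imp_le order_trans)
    qed
    also have "\<dots> \<le> (\<Sum>n. ennreal (K powr s) * diam_power s (U n))"
    proof (intro suminf_le allI)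
      fix n
      have "diameter (V n) powr s \<le> (K * diameter (U n)) powr s"
        using diam bdd s by (intro powr_mono2) (auto simp: diameter_ge_0)
      then show "diam_power s (V n) \<le> ennreal (K powr s) * diam_power s (U n)"
        using s K dU[of n]
        by (auto simp: diam_power_def V_def powr_mult ennreal_leI simp flip: ennreal_mult)
    qed auto
    also have "\<dots> = ennreal (K powr s) * (\<Sum>n. diam_power s (U n))"
      by (rule ennreal_suminf_cmult)
    finally have "ennreal (K powr - s) * hausdorff_content s \<delta> (f ` Q)
        \<le> ennreal (K powr - s) * (ennreal (K powr s) * (\<Sum>n. diam_power s (U n)))"
      by (intro mult_left_mono) auto
    also have "\<dots> = (\<Sum>n. diam_power s (U n))"
      using K by (simp add: powr_minus flip: mult.assoc ennreal_mult)
    finally show "ennreal (K powr - s) * hausdorff_content s \<delta> (f ` Q) \<le> (\<Sum>n. diam_power s (U n))" .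
  qed
  then have "ennreal (K powr s) * (ennreal (K powr - s) * hausdorff_content s \<delta> (f ` Q))
      \<le> ennreal (K powr s) * hausdorff_content s \<delta> Q"
    by (intro mult_left_mono) auto
  then show ?thesis
    using K by (simp add: powr_minus flip: mult.assoc ennreal_mult)
qed

lemma hausdorff_content_unit_interval_finite:
  assumes "0 < \<delta>" "0 < s"
  shows "hausdorff_content s \<delta> {0..1::real} < top"
proof -
  obtain N :: nat where N: "1 / \<delta> \<le> real N"
    using real_arch_simple by blast
  define U where "U i = (if i < N then {real i * \<delta>..real (Suc i) * \<delta>} else {})" for i
  have "hausdorff_content s \<delta> {0..1::real} \<le> (\<Sum>i. diam_power s (U i))"
  proof (rule hausdorff_content_le_cover)
    show "{0..1} \<subseteq> (\<Union>i. U i)"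
    proof
      fix x :: real
      assume x: "x \<in> {0..1}"
      show "x \<in> (\<Union>i. U i)"
      proof (cases "x = real N * \<delta>")
        case True
        with x N assms have "0 < N" by (cases N) (auto simp: field_simps)
        then have "x \<in> U (N - 1)"
          using True assms by (auto simp: U_def of_nat_diff)
        then show ?thesis by blast
      next
        case False
        have "x \<le> real N * \<delta>"
          using x N assms by (auto simp: field_simps)
        with False have "x / \<delta> < real N"
          using assms by (simp add: field_simps)
        moreover have "0 \<le> x / \<delta>"
          using x assms by auto
        ultimately have "nat \<lfloor>x / \<delta>\<rfloor> < N"
          by linarith
        moreover have "real (nat \<lfloor>x / \<delta>\<rfloor>) \<le> x / \<delta>" "x / \<delta> \<le> real (Suc (nat \<lfloor>x / \<delta>\<rfloor>))"
          using \<open>0 \<le> x / \<delta>\<close> by linarith+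
        ultimately have "x \<in> U (nat \<lfloor>x / \<delta>\<rfloor>)"
          using assms by (simp add: U_def pos_le_divide_eq pos_divide_le_eq)
        then show ?thesis by blast
      qed
    qed
    show "bounded (U i) \<and> diameter (U i) \<le> \<delta>" for i
      using assms by (auto simp: U_def algebra_simps)
  qed
  also have "\<dots> = (\<Sum>i<N. diam_power s (U i))"
    by (intro suminf_finite) (auto simp: U_def diam_power_def)
  also have "\<dots> < top"
    using assms by (simp add: diam_power_def less_top)
  finally show ?thesis .
qed

section \<open>Blocks that contain a large partial quotient\<close>

text \<open>
  The Riemann zeta function on the reals, with values in the extended nonnegative reals, where
  contents live.
\<close>

definition digit_zeta :: "real \<Rightarrow> ennreal" where
  "digit_zeta t = (\<Sum>n. ennreal (real (Suc n) powr - t))"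

lemma digit_zeta_finite:
  assumes "t > 1"
  shows "digit_zeta t < top"
proof -
  have "summable (\<lambda>n. real n powr - t)"
    using assms by (simp add: summable_real_powr_iff)
  then have "summable (\<lambda>n. real (Suc n) powr - t)"
    by (subst summable_Suc_iff)
  then show ?thesis
    unfolding digit_zeta_def by (subst suminf_ennreal2) auto
qed

lemma digit_zeta_ge_1: "1 \<le> digit_zeta t"
proof -
  have "(\<Sum>n<1. ennreal (real (Suc n) powr - t)) \<le> digit_zeta t"
    unfolding digit_zeta_def by (rule sum_le_suminf) auto
  then show ?thesis
    by simp
qed

text \<open>
  Prescribing the first digit \<open>a\<close> amounts to applying the inverse branch \<open>t \<mapsto> 1 / (a + t)\<close>, which is
  Lipschitz with constant \<open>1 / a\<^sup>2\<close>.
\<close>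

lemma hausdorff_content_first_digit_eq:
  assumes Q: "Q \<subseteq> unit_irrationals" and a: "a \<ge> 1" and s: "0 < s"
  shows "hausdorff_content s \<delta> {x \<in> unit_irrationals. cf_coeff x 1 = a \<and> gauss_map x \<in> Q}
    \<le> ennreal (real a powr (- 2 * s)) * hausdorff_content s \<delta> Q"
proof -
  let ?f = "\<lambda>t. 1 / (real a + t)"
  have "{x \<in> unit_irrationals. cf_coeff x 1 = a \<and> gauss_map x \<in> Q} \<subseteq> ?f ` Q"
    using unit_irrationals_eq by blast
  then have "hausdorff_content s \<delta> {x \<in> unit_irrationals. cf_coeff x 1 = a \<and> gauss_map x \<in> Q}
      \<le> hausdorff_content s \<delta> (?f ` Q)"
    by (rule hausdorff_content_mono)
  also have "\<dots> \<le> ennreal ((real a powr - 2) powr s) * hausdorff_content s \<delta> Q"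
  proof (rule hausdorff_content_lipschitz_image)
    fix u v
    assume "u \<in> Q" "v \<in> Q"
    then have uv: "0 < u" "0 < v"
      using Q unit_irrationals_pos by auto
    have "?f u - ?f v = ((real a + v) - (real a + u)) / ((real a + u) * (real a + v))"
      using uv a by (intro inverse_shift_diff) auto
    then have "\<bar>?f u - ?f v\<bar> = \<bar>u - v\<bar> / ((real a + u) * (real a + v))"
      using uv by (simp add: abs_mult abs_minus_commute)
    also have "\<dots> \<le> \<bar>u - v\<bar> / (real a * real a)"
      using uv a by (intro divide_left_mono mult_mono) auto
    also have "\<dots> = real a powr - 2 * \<bar>u - v\<bar>"
      using a by (simp add: powr_minus powr_numeral power2_eq_square divide_simps)
    finally show "dist (?f u) (?f v) \<le> real a powr - 2 * dist u v"
      by (simp add: dist_real_def)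
  next
    show "real a powr - 2 \<le> 1"
      using a by (simp add: powr_minus powr_numeral divide_simps)
  qed (use a s in auto)
  finally show ?thesis
    by (simp add: powr_powr)
qed

text \<open>
  Splitting \<open>a powr (- 2 * s)\<close> as \<open>a powr - (s - 1 / 2) * a powr - (s + 1 / 2)\<close> leaves a summable
  factor and still gains a power of the lower bound \<open>M\<close> on the digit.
\<close>

lemma hausdorff_content_first_digit_ge:
  assumes Q: "Q \<subseteq> unit_irrationals" and s: "1 / 2 < s" and M: "0 < M" and \<delta>: "0 \<le> \<delta>"
  shows "hausdorff_content s \<delta> {x \<in> unit_irrationals. M \<le> real (cf_coeff x 1) \<and> gauss_map x \<in> Q}
    \<le> ennreal (M powr - (s - 1 / 2)) * digit_zeta (s + 1 / 2) * hausdorff_content s \<delta> Q"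
proof -
  let ?C = "hausdorff_content s \<delta>"
  define F where "F n = {x \<in> unit_irrationals. cf_coeff x 1 = Suc n \<and> M \<le> real (Suc n) \<and> gauss_map x \<in> Q}"
    for n
  have "{x \<in> unit_irrationals. M \<le> real (cf_coeff x 1) \<and> gauss_map x \<in> Q} \<subseteq> (\<Union>n. F n)"
  proof
    fix x
    assume x: "x \<in> {x \<in> unit_irrationals. M \<le> real (cf_coeff x 1) \<and> gauss_map x \<in> Q}"
    then have "x \<in> F (cf_coeff x 1 - 1)"
      using cf_coeff_pos[of x 1] by (auto simp: F_def)
    then show "x \<in> (\<Union>n. F n)"
      by blast
  qed
  then have "?C {x \<in> unit_irrationals. M \<le> real (cf_coeff x 1) \<and> gauss_map x \<in> Q} \<le> ?C (\<Union>n. F n)"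
    by (rule hausdorff_content_mono)
  also have "\<dots> \<le> (\<Sum>n. ?C (F n))"
    by (rule hausdorff_content_countable_UN)
  also have "\<dots> \<le> (\<Sum>n. ennreal (M powr - (s - 1 / 2)) * ?C Q * ennreal (real (Suc n) powr - (s + 1 / 2)))"
  proof (intro suminf_le allI)
    fix n
    show "?C (F n) \<le> ennreal (M powr - (s - 1 / 2)) * ?C Q * ennreal (real (Suc n) powr - (s + 1 / 2))"
    proof (cases "M \<le> real (Suc n)")
      case M_le: True
      have "real (Suc n) powr - (s - 1 / 2) \<le> M powr - (s - 1 / 2)"
        using s M M_le by (intro powr_mono2') auto
      then have "real (Suc n) powr - (s - 1 / 2) * real (Suc n) powr - (s + 1 / 2)
          \<le> M powr - (s - 1 / 2) * real (Suc n) powr - (s + 1 / 2)"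
        by (intro mult_right_mono) auto
      then have le: "real (Suc n) powr (- 2 * s) \<le> M powr - (s - 1 / 2) * real (Suc n) powr - (s + 1 / 2)"
        by (simp flip: powr_add)
      have "F n = {x \<in> unit_irrationals. cf_coeff x 1 = Suc n \<and> gauss_map x \<in> Q}"
        using M_le by (auto simp: F_def)
      then have "?C (F n) \<le> ennreal (real (Suc n) powr (- 2 * s)) * ?C Q"
        using hausdorff_content_first_digit_eq[OF Q, of "Suc n" s \<delta>] s by simp
      also have "\<dots> \<le> ennreal (M powr - (s - 1 / 2) * real (Suc n) powr - (s + 1 / 2)) * ?C Q"
        by (intro mult_right_mono ennreal_leI le) auto
      finally show ?thesis
        by (simp add: ennreal_mult mult_ac)
    next
      case False
      then have "F n = {}"
        by (auto simp: F_def)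
      with \<delta> show ?thesis
        by (simp add: hausdorff_content_empty)
    qed
  qed auto
  also have "\<dots> = ennreal (M powr - (s - 1 / 2)) * digit_zeta (s + 1 / 2) * ?C Q"
    by (simp only: ennreal_suminf_cmult digit_zeta_def mult_ac)
  finally show ?thesis .
qed

text \<open>Each unrestricted digit costs one factor \<open>digit_zeta (s + 1 / 2)\<close>.\<close>

lemma hausdorff_content_gauss_vimage:
  assumes Q: "Q \<subseteq> unit_irrationals" and s: "1 / 2 < s" and \<delta>: "0 \<le> \<delta>"
  shows "hausdorff_content s \<delta> {x \<in> unit_irrationals. (gauss_map ^^ l) x \<in> Q}
    \<le> digit_zeta (s + 1 / 2) ^ l * hausdorff_content s \<delta> Q"
proof (induction l)
  case 0
  show ?case
    using Q by (auto intro!: hausdorff_content_mono)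
next
  case (Suc l)
  let ?Q = "{x \<in> unit_irrationals. (gauss_map ^^ l) x \<in> Q}"
  have "{x \<in> unit_irrationals. (gauss_map ^^ Suc l) x \<in> Q}
      \<subseteq> {x \<in> unit_irrationals. 1 \<le> real (cf_coeff x 1) \<and> gauss_map x \<in> ?Q}"
    using cf_coeff_pos gauss_map_unit_irrationals by (auto simp: funpow_swap1)
  then have "hausdorff_content s \<delta> {x \<in> unit_irrationals. (gauss_map ^^ Suc l) x \<in> Q}
      \<le> hausdorff_content s \<delta> {x \<in> unit_irrationals. 1 \<le> real (cf_coeff x 1) \<and> gauss_map x \<in> ?Q}"
    by (rule hausdorff_content_mono)
  also have "\<dots> \<le> ennreal (1 powr - (s - 1 / 2)) * digit_zeta (s + 1 / 2) * hausdorff_content s \<delta> ?Q"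
    using s \<delta> by (intro hausdorff_content_first_digit_ge) auto
  also have "\<dots> \<le> digit_zeta (s + 1 / 2) * (digit_zeta (s + 1 / 2) ^ l * hausdorff_content s \<delta> Q)"
    using Suc.IH by (simp add: mult_left_mono)
  finally show ?case
    by (simp add: mult.assoc)
qed

text \<open>
  A union bound over the position \<open>k\<close> of the large digit: the \<open>k\<close> digits before it, the digit itself
  and the \<open>l - k - 1\<close> digits after it contribute one zeta factor each, and the large digit also
  contributes its gain.
\<close>

lemma hausdorff_content_block_with_large_digit:
  assumes Q: "Q \<subseteq> unit_irrationals" and s: "1 / 2 < s" and M: "0 < M" and \<delta>: "0 \<le> \<delta>"
  shows "hausdorff_content s \<delta>
      {x \<in> unit_irrationals. (\<exists>k<l. M \<le> real (cf_coeff x (Suc k))) \<and> (gauss_map ^^ l) x \<in> Q}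
    \<le> of_nat l * ennreal (M powr - (s - 1 / 2)) * digit_zeta (s + 1 / 2) ^ l * hausdorff_content s \<delta> Q"
proof -
  let ?C = "hausdorff_content s \<delta>" and ?Z = "digit_zeta (s + 1 / 2)"
  define R where "R j = {z \<in> unit_irrationals. (gauss_map ^^ j) z \<in> Q}" for j
  define G where "G j = {y \<in> unit_irrationals. M \<le> real (cf_coeff y 1) \<and> gauss_map y \<in> R j}" for j
  define F where "F k = {x \<in> unit_irrationals. (gauss_map ^^ k) x \<in> G (l - Suc k)}" for k
  have F: "?C (F k) \<le> ennreal (M powr - (s - 1 / 2)) * ?Z ^ l * ?C Q" if "k < l" for k
  proof -
    have "?C (F k) \<le> ?Z ^ k * ?C (G (l - Suc k))"
      unfolding F_def by (rule hausdorff_content_gauss_vimage) (use s \<delta> in \<open>auto simp: G_def\<close>)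
    also have "?C (G (l - Suc k)) \<le> ennreal (M powr - (s - 1 / 2)) * ?Z * ?C (R (l - Suc k))"
      unfolding G_def
      by (rule hausdorff_content_first_digit_ge) (use s \<delta> M in \<open>auto simp: R_def\<close>)
    also have "?C (R (l - Suc k)) \<le> ?Z ^ (l - Suc k) * ?C Q"
      unfolding R_def by (rule hausdorff_content_gauss_vimage[OF Q s \<delta>])
    finally have "?C (F k)
        \<le> ?Z ^ k * (ennreal (M powr - (s - 1 / 2)) * ?Z * (?Z ^ (l - Suc k) * ?C Q))"
      by (simp add: mult_left_mono)
    also have "\<dots> = ennreal (M powr - (s - 1 / 2)) * ?Z ^ (k + Suc (l - Suc k)) * ?C Q"
      by (simp add: power_add mult_ac)
    finally show ?thesis
      using that by simp
  qed
  have "{x \<in> unit_irrationals. (\<exists>k<l. M \<le> real (cf_coeff x (Suc k))) \<and> (gauss_map ^^ l) x \<in> Q}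
      \<subseteq> (\<Union>k<l. F k)"
  proof safe
    fix x k
    assume x: "x \<in> unit_irrationals" "(gauss_map ^^ l) x \<in> Q"
      and k: "k < l" "M \<le> real (cf_coeff x (Suc k))"
    have irr: "(gauss_map ^^ j) x \<in> unit_irrationals" for j
      using x(1) by (rule funpow_gauss_map_unit_irrationals)
    have step: "gauss_map ((gauss_map ^^ k) x) = (gauss_map ^^ Suc k) x"
      by simp
    have "(gauss_map ^^ (l - Suc k)) ((gauss_map ^^ Suc k) x) = (gauss_map ^^ l) x"
      using k(1) by (simp only: funpow_add[THEN fun_cong, unfolded o_apply, symmetric]) simp
    then have "x \<in> F k"
      using x k irr by (simp only: F_def G_def R_def mem_Collect_eq step) (simp add: cf_coeff_funpow_gauss_map)
    with k(1) show "x \<in> (\<Union>k<l. F k)"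
      by blast
  qed
  then have "?C {x \<in> unit_irrationals. (\<exists>k<l. M \<le> real (cf_coeff x (Suc k))) \<and> (gauss_map ^^ l) x \<in> Q}
      \<le> ?C (\<Union>k<l. F k)"
    by (rule hausdorff_content_mono)
  also have "\<dots> \<le> (\<Sum>k<l. ?C (F k))"
    using \<delta> by (rule hausdorff_content_finite_UN)
  also have "\<dots> \<le> (\<Sum>k<l. ennreal (M powr - (s - 1 / 2)) * ?Z ^ l * ?C Q)"
    by (intro sum_mono F) auto
  finally show ?thesis
    by (simp add: mult.assoc)
qed

text \<open>
  From some block on, prescribing one more block at least halves the content, so the tails that obey
  all later prescriptions form a set of content zero.  The digits before that block are arbitrary:
  they cost a finite factor, and the index of the block ranges over a countable set.
\<close>

lemma hausdorff_measure_zero_of_large_digit_blocks: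
  fixes n :: "nat \<Rightarrow> nat" and M :: "nat \<Rightarrow> real"
  assumes s: "1 / 2 < s" and n: "mono n" and M: "\<And>j. 0 < M j"
    and small: "\<forall>\<^sub>F j in sequentially. of_nat (n (Suc j) - n j) * ennreal (M j powr - (s - 1 / 2))
      * digit_zeta (s + 1 / 2) ^ (n (Suc j) - n j) \<le> ennreal (1 / 2)"
    and E: "E \<subseteq> unit_irrationals"
    and large: "\<And>x. x \<in> E \<Longrightarrow>
      \<forall>\<^sub>F j in sequentially. \<exists>k\<in>{n j<..n (Suc j)}. M j \<le> real (cf_coeff x k)"
  shows "hausdorff_measure s E = 0"
proof -
  have "hausdorff_content s \<delta> E = 0" if \<delta>: "0 < \<delta>" for \<delta>
  proof -
    let ?C = "hausdorff_content s \<delta>" and ?Z = "digit_zeta (s + 1 / 2)"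
    \<comment> \<open>Indices are shifted by \<open>n j\<close>: a point of \<open>P j\<close> is meant as the tail after
      the first \<open>n j\<close> digits have been removed.\<close>
    define P where
      "P j = {x \<in> unit_irrationals. \<forall>i\<ge>j. \<exists>k\<in>{n i<..n (Suc i)}. M i \<le> real (cf_coeff x (k - n j))}" for j
    have P_irr: "P j \<subseteq> unit_irrationals" for j
      by (auto simp: P_def)
    obtain J where J: "\<And>j. j \<ge> J \<Longrightarrow> of_nat (n (Suc j) - n j) * ennreal (M j powr - (s - 1 / 2))
        * ?Z ^ (n (Suc j) - n j) \<le> ennreal (1 / 2)"
      using small unfolding eventually_sequentially by blast
    have step: "?C (P j) \<le> ennreal (1 / 2) * ?C (P (Suc j))" if j: "j \<ge> J" for j
    proof -
      define l where "l = n (Suc j) - n j"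
      have nj: "n (Suc j) = n j + l"
        using n by (simp add: l_def mono_def)
      have "P j \<subseteq> {x \<in> unit_irrationals. (\<exists>k<l. M j \<le> real (cf_coeff x (Suc k)))
          \<and> (gauss_map ^^ l) x \<in> P (Suc j)}"
      proof
        fix x
        assume x: "x \<in> P j"
        then have irr: "x \<in> unit_irrationals"
          by (simp add: P_def)
        obtain k where k: "k \<in> {n j<..n (Suc j)}" "M j \<le> real (cf_coeff x (k - n j))"
          using x unfolding P_def by blast
        then have "k - n j - 1 < l \<and> M j \<le> real (cf_coeff x (Suc (k - n j - 1)))"
          by (auto simp: nj Suc_diff_Suc)
        moreover have "(gauss_map ^^ l) x \<in> P (Suc j)"
        proof -
          have "\<exists>k\<in>{n i<..n (Suc i)}. M i \<le> real (cf_coeff ((gauss_map ^^ l) x) (k - n (Suc j)))"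
            if i: "i \<ge> Suc j" for i
          proof -
            obtain k where k: "k \<in> {n i<..n (Suc i)}" "M i \<le> real (cf_coeff x (k - n j))"
              using x Suc_leD[OF i] unfolding P_def by blast
            have "n (Suc j) \<le> n i"
              using n i by (simp add: mono_def)
            with k(1) have "n (Suc j) < k"
              by simp
            then have "cf_coeff ((gauss_map ^^ l) x) (k - n (Suc j)) = cf_coeff x (k - n j)"
              by (subst cf_coeff_funpow_gauss_map) (auto simp: nj)
            with k show ?thesis
              by (intro bexI[of _ k]) auto
          qed
          then show ?thesis
            using funpow_gauss_map_unit_irrationals[OF irr] by (simp add: P_def)
        qed
        ultimately show "x \<in> {x \<in> unit_irrationals. (\<exists>k<l. M j \<le> real (cf_coeff x (Suc k)))
          \<and> (gauss_map ^^ l) x \<in> P (Suc j)}"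
          using irr by blast
      qed
      then have "?C (P j) \<le> ?C {x \<in> unit_irrationals. (\<exists>k<l. M j \<le> real (cf_coeff x (Suc k)))
          \<and> (gauss_map ^^ l) x \<in> P (Suc j)}"
        by (rule hausdorff_content_mono)
      also have "\<dots> \<le> of_nat l * ennreal (M j powr - (s - 1 / 2)) * ?Z ^ l * ?C (P (Suc j))"
        using \<delta> s M P_irr by (intro hausdorff_content_block_with_large_digit) auto
      also have "\<dots> \<le> ennreal (1 / 2) * ?C (P (Suc j))"
        using J[OF j] by (intro mult_right_mono) (auto simp: l_def)
      finally show ?thesis .
    qed
    have iterate: "?C (P j) \<le> ennreal ((1 / 2) ^ i) * ?C {0..1::real}" if j: "j \<ge> J" for i j
      using j
    proof (induction i arbitrary: j)
      case 0
      have "P j \<subseteq> {0..1}"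
        using P_irr[of j] by (auto simp: unit_irrationals_def)
      then show ?case
        by (simp add: hausdorff_content_mono)
    next
      case (Suc i)
      have "?C (P j) \<le> ennreal (1 / 2) * ?C (P (Suc j))"
        by (rule step[OF Suc.prems])
      also have "\<dots> \<le> ennreal (1 / 2) * (ennreal ((1 / 2) ^ i) * ?C {0..1::real})"
        using Suc by (intro mult_left_mono) auto
      also have "\<dots> = ennreal ((1 / 2) ^ Suc i) * ?C {0..1::real}"
      proof -
        have "ennreal ((1 / 2) ^ Suc i) = ennreal (1 / 2) * ennreal ((1 / 2) ^ i)"
          unfolding power_Suc by (rule ennreal_mult) auto
        then show ?thesis
          by (simp only: mult.assoc)
      qed
      finally show ?case .
    qed
    have P0: "?C (P j) = 0" if "j \<ge> J" for j
    proof -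
      have "(\<lambda>i. ennreal ((1 / 2) ^ i) * ?C {0..1::real}) \<longlonglongrightarrow> ennreal 0 * ?C {0..1::real}"
        using hausdorff_content_unit_interval_finite[OF \<delta>, of s] s
        by (intro tendsto_mult_ennreal tendsto_ennrealI LIMSEQ_power_zero tendsto_const) auto
      then have "?C (P j) \<le> ennreal 0 * ?C {0..1::real}"
        by (rule LIMSEQ_le_const) (use iterate[OF that] in auto)
      then show ?thesis
        by simp
    qed
    define F where "F j = {x \<in> unit_irrationals. (gauss_map ^^ n (J + j)) x \<in> P (J + j)}" for j
    have "E \<subseteq> (\<Union>j. F j)"
    proof
      fix x
      assume x: "x \<in> E"
      then obtain j where j: "\<And>i. i \<ge> j \<Longrightarrow> \<exists>k\<in>{n i<..n (Suc i)}. M i \<le> real (cf_coeff x k)"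
        using large unfolding eventually_sequentially by blast
      have irr: "x \<in> unit_irrationals"
        using x E by blast
      have "\<exists>k\<in>{n i<..n (Suc i)}.
          M i \<le> real (cf_coeff ((gauss_map ^^ n (J + j)) x) (k - n (J + j)))" if i: "i \<ge> J + j" for i
      proof -
        obtain k where k: "k \<in> {n i<..n (Suc i)}" "M i \<le> real (cf_coeff x k)"
          using j[of i] i by auto
        moreover have "n (J + j) \<le> n i"
          using n i by (simp add: mono_def)
        ultimately have "n (J + j) < k"
          by simp
        then have "cf_coeff ((gauss_map ^^ n (J + j)) x) (k - n (J + j)) = cf_coeff x k"
          by (subst cf_coeff_funpow_gauss_map) auto
        with k show ?thesis
          by (intro bexI[of _ k]) auto
      qed
      then have "x \<in> F j"
        using irr funpow_gauss_map_unit_irrationals[OF irr] by (simp add: F_def P_def)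
      then show "x \<in> (\<Union>j. F j)"
        by blast
    qed
    have F0: "?C (F j) = 0" for j
      using hausdorff_content_gauss_vimage[OF P_irr, of s \<delta> "n (J + j)" "J + j"] P0[of "J + j"] s \<delta>
      by (simp add: F_def)
    have "?C E \<le> ?C (\<Union>j. F j)"
      using \<open>E \<subseteq> (\<Union>j. F j)\<close> by (rule hausdorff_content_mono)
    also have "\<dots> \<le> (\<Sum>j. ?C (F j))"
      by (rule hausdorff_content_countable_UN)
    finally show ?thesis
      by (simp add: F0)
  qed
  then show ?thesis
    by (simp add: hausdorff_measure_def)
qed

section \<open>A Cantor set of prescribed digit ranges\<close>

text \<open>
  Give the digits independent uniform distributions.  The cylinder of depth \<open>n\<close> then has mass
  \<open>\<mu> n = (\<Prod>k<n. 1 / N k)\<close>, and points closer than \<open>g n\<close> share their first \<open>n\<close> digits.  A set whose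
  diameter lies between \<open>g (n + 1)\<close> and \<open>g n\<close> therefore has mass at most \<open>\<mu> n\<close>, which the growth
  condition bounds by a constant times \<open>g (n + 1) powr s\<close>: the mass distribution principle applies.
\<close>

lemma hausdorff_measure_digit_cantor_set_nonzero:
  fixes L N :: "nat \<Rightarrow> nat" and s :: real
  assumes s: "0 \<le> s" and L: "\<And>k. 2 \<le> L k" and N: "\<And>k. 1 \<le> N k"
    and growth: "\<forall>\<^sub>F k in sequentially. real (L (Suc k) + N (Suc k)) powr (2 * s) \<le> real (N k)"
    and E: "{x \<in> unit_irrationals. \<forall>k. cf_coeff x (Suc k) \<in> {L k..<L k + N k}} \<subseteq> E"
  shows "hausdorff_measure s E \<noteq> 0"
proof
  assume zero: "hausdorff_measure s E = 0"
  define A where "A k = L k + N k" for k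
  define g where "g n = (\<Prod>k<n. 1 / real (A k) ^ 2) / 2" for n
  define \<mu> where "\<mu> n = (\<Prod>k<n. 1 / real (N k))" for n
  have A3: "3 \<le> A k" for k
    using L[of k] N[of k] by (simp add: A_def)
  have Npos: "0 < real (N k)" for k
    using N[of k] by simp
  have Apos: "0 < real (A k)" for k
    using A3[of k] by simp
  have g_pos: "0 < g n" for n
    unfolding g_def using Apos by (intro divide_pos_pos prod_pos) auto
  have \<mu>_pos: "0 < \<mu> n" for n
    unfolding \<mu>_def using Npos by (intro prod_pos) auto
  have g_le: "g n \<le> (1 / 4) ^ n" for n
  proof -
    have "(\<Prod>k<n. 1 / real (A k) ^ 2) \<le> (\<Prod>k<n. 1 / 4)"
    proof (intro prod_mono conjI)
      fix k
      have "2 ^ 2 \<le> real (A k) ^ 2"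
        using A3[of k] by (intro power_mono) auto
      then show "1 / real (A k) ^ 2 \<le> 1 / 4"
        using Apos[of k] by (intro divide_left_mono) auto
    qed auto
    then have "(\<Prod>k<n. 1 / real (A k) ^ 2) \<le> (1 / 4) ^ n"
      by simp
    moreover have "0 < (\<Prod>k<n. 1 / real (A k) ^ 2)"
      using Apos by (intro prod_pos) auto
    ultimately show ?thesis
      unfolding g_def by linarith
  qed
  have g_lim: "g \<longlonglongrightarrow> 0"
  proof (rule tendsto_sandwich[of "\<lambda>_. 0" g _ "\<lambda>n. (1 / 4) ^ n"])
    show "(\<lambda>n. (1 / 4 :: real) ^ n) \<longlonglongrightarrow> 0"
      by (rule LIMSEQ_power_zero) simp
  qed (use g_le in \<open>auto simp: less_imp_le[OF g_pos]\<close>)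

  \<comment> \<open>The mass of a cylinder against the next scale.\<close>
  define \<rho> where "\<rho> n = \<mu> n * g (Suc n) powr - s" for n
  have \<rho>_nonneg: "0 \<le> \<rho> n" for n
    using \<mu>_pos[of n] by (simp add: \<rho>_def)
  have \<rho>_Suc: "\<rho> (Suc n) = \<rho> n * (real (A (Suc n)) powr (2 * s) / real (N n))" for n
  proof -
    have "g (Suc (Suc n)) = g (Suc n) * (1 / real (A (Suc n)) ^ 2)"
      by (simp add: g_def)
    also have "\<dots> = g (Suc n) * real (A (Suc n)) powr - 2"
      using Apos[of "Suc n"] by (simp add: powr_minus powr_numeral divide_simps)
    finally have "g (Suc (Suc n)) powr - s = g (Suc n) powr - s * real (A (Suc n)) powr (2 * s)"
      using g_pos[of "Suc n"] by (simp add: powr_mult powr_powr)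
    then show ?thesis
      by (simp add: \<rho>_def \<mu>_def)
  qed
  obtain J where J: "\<And>k. k \<ge> J \<Longrightarrow> real (A (Suc k)) powr (2 * s) \<le> real (N k)"
    using growth unfolding eventually_sequentially A_def by blast
  have \<rho>_J: "\<rho> n \<le> \<rho> J" if "n \<ge> J" for n
    using that
  proof (induction n rule: dec_induct)
    case (step n)
    have "real (A (Suc n)) powr (2 * s) / real (N n) \<le> 1"
      using J[of n] step Npos[of n] by simp
    then have "\<rho> (Suc n) \<le> \<rho> n"
      unfolding \<rho>_Suc using \<rho>_nonneg[of n] by (intro mult_left_le) auto
    with step show ?case
      by simp
  qed simp
  \<comment> \<open>The summand \<open>1\<close> makes \<open>C\<close> at least \<open>1\<close>, the mass of the whole set, as the case \<open>s = 0\<close> demands.\<close>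
  define C where "C = (\<Sum>i\<le>J. \<rho> i) + 1"
  have C1: "C \<ge> 1"
    unfolding C_def using \<rho>_nonneg by (simp add: sum_nonneg)
  have \<rho>_C: "\<rho> n \<le> C" for n
  proof -
    have "\<rho> (min n J) \<le> (\<Sum>i\<le>J. \<rho> i)"
      using \<rho>_nonneg by (intro member_le_sum) auto
    moreover have "\<rho> n \<le> \<rho> (min n J)"
      using \<rho>_J[of n] by (cases "n \<le> J") auto
    ultimately show ?thesis
      unfolding C_def by linarith
  qed
  have \<mu>_le: "\<mu> n \<le> C * g (Suc n) powr s" for n
  proof -
    have "\<mu> n = \<rho> n * g (Suc n) powr s"
      using g_pos[of "Suc n"] by (simp add: \<rho>_def powr_minus)
    then show ?thesis
      using \<rho>_C[of n] by (simp add: mult_right_mono)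
  qed

  define \<Omega> where "\<Omega> = (\<Pi>\<^sub>E k\<in>UNIV. {..<N k})"
  have "\<exists>x \<in> unit_irrationals. \<forall>k. cf_coeff x (Suc k) = L k + \<omega> k" for \<omega>
    by (rule ex_unit_irrational_cf_coeff) (use L in \<open>simp add: le_trans[OF _ trans_le_add1[OF L]]\<close>)
  then obtain X where X: "\<And>\<omega>. X \<omega> \<in> unit_irrationals"
      "\<And>\<omega> k. cf_coeff (X \<omega>) (Suc k) = L k + \<omega> k"
    by metis
  have \<Omega>_less: "\<omega> k < N k" if "\<omega> \<in> \<Omega>" for \<omega> k
    using that by (auto simp: \<Omega>_def)
  have X_E: "X \<omega> \<in> E" if "\<omega> \<in> \<Omega>" for \<omega>
    using E X \<Omega>_less[OF that] by auto
  have X_sep: "\<forall>k<n. \<omega> k = \<omega>' k"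
    if "\<omega> \<in> \<Omega>" "\<omega>' \<in> \<Omega>" "\<bar>X \<omega> - X \<omega>'\<bar> < g n" for \<omega> \<omega>' n
  proof (rule ccontr)
    assume "\<not> (\<forall>k<n. \<omega> k = \<omega>' k)"
    then have "(\<Prod>k<n. 1 / real (A k) ^ 2) / 2 \<le> \<bar>X \<omega> - X \<omega>'\<bar>"
      using that(1,2) \<Omega>_less L
      by (intro cf_separation) (auto simp: X A_def intro: trans_le_add1)
    with that(3) show False
      by (simp add: g_def)
  qed

  define D where "D k = uniform_count_measure {..<N k}" for k
  interpret product_prob_space D UNIV
  proof (rule product_prob_spaceI)
    show "prob_space (D i)" for i
      unfolding D_def using N[of i]
      by (intro prob_space_uniform_count_measure) (auto simp: lessThan_empty_iff)
  qed
  let ?P = "Pi\<^sub>M UNIV D"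
  have space_P: "space ?P = \<Omega>"
    by (simp add: space_PiM \<Omega>_def D_def space_uniform_count_measure)
  define cyl where "cyl n \<omega> = prod_emb UNIV D {..<n} (\<Pi>\<^sub>E k\<in>{..<n}. {\<omega> k})" for n \<omega>
  have cyl_iff: "\<omega>' \<in> cyl n \<omega> \<longleftrightarrow> \<omega>' \<in> \<Omega> \<and> (\<forall>k<n. \<omega> k = \<omega>' k)" for n \<omega> \<omega>'
    by (auto simp: cyl_def prod_emb_iff \<Omega>_def D_def space_uniform_count_measure restrict_PiE_iff
        extensional_UNIV PiE_iff)
  have cyl: "cyl n \<omega> \<in> sets ?P \<and> emeasure ?P (cyl n \<omega>) = ennreal (\<mu> n)" if "\<omega> \<in> \<Omega>" for n \<omega>
  proof
    have in_sets: "{\<omega> k} \<in> sets (D k)" for k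
      using \<Omega>_less[OF that] by (auto simp: D_def sets_uniform_count_measure)
    then show "cyl n \<omega> \<in> sets ?P"
      unfolding cyl_def by (intro sets_PiM_I) auto
    have "emeasure ?P (cyl n \<omega>) = (\<Prod>k<n. emeasure (D k) {\<omega> k})"
      unfolding cyl_def using in_sets by (intro emeasure_PiM_emb) auto
    also have "\<dots> = (\<Prod>k<n. ennreal (1 / real (N k)))"
      using \<Omega>_less[OF that] by (intro prod.cong) (auto simp: D_def emeasure_uniform_count_measure)
    also have "\<dots> = ennreal (\<mu> n)"
      unfolding \<mu>_def by (intro prod_ennreal) auto
    finally show "emeasure ?P (cyl n \<omega>) = ennreal (\<mu> n)" .
  qed

  have mass: "\<exists>B\<in>sets ?P. {\<omega>\<in>\<Omega>. X \<omega> \<in> V} \<subseteq> B \<and> emeasure ?P B \<le> ennreal C * diam_power s V"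
    if bdd: "bounded V" and small: "diameter V < g 0" for V
  proof (cases "{\<omega>\<in>\<Omega>. X \<omega> \<in> V} = {}")
    case True
    then show ?thesis
      by (intro bexI[of _ "{}"]) auto
  next
    case False
    then obtain \<omega> where \<omega>: "\<omega> \<in> \<Omega>" "X \<omega> \<in> V"
      by blast
    define d where "d = diameter V"
    have d: "0 \<le> d"
      using bdd by (simp add: d_def diameter_ge_0)
    have sub: "{\<omega>\<in>\<Omega>. X \<omega> \<in> V} \<subseteq> cyl n \<omega>" if "d < g n" for n
    proof clarify
      fix \<omega>'
      assume \<omega>': "\<omega>' \<in> \<Omega>" "X \<omega>' \<in> V"
      have "\<bar>X \<omega> - X \<omega>'\<bar> \<le> d"
        using diameter_bounded_bound[OF bdd \<omega>(2) \<omega>'(2)] by (simp add: d_def dist_real_def)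
      with that have "\<forall>k<n. \<omega> k = \<omega>' k"
        by (intro X_sep \<omega> \<omega>') auto
      with \<omega>' show "\<omega>' \<in> cyl n \<omega>"
        by (simp add: cyl_iff)
    qed
    show ?thesis
    proof (cases "s = 0 \<or> 0 < d")
      case True
      have "\<exists>n. d < g n \<and> \<mu> n \<le> C * (if s = 0 then 1 else d powr s)"
      proof (cases "s = 0")
        case True
        then show ?thesis
          using small C1 by (intro exI[of _ 0]) (auto simp: d_def \<mu>_def)
      next
        case False
        with True have "0 < d"
          by simp
        then have "\<forall>\<^sub>F n in sequentially. g n < d"
          using g_lim by (simp add: order_tendstoD)
        then obtain m where "g m \<le> d"
          by (metis eventually_sequentially less_imp_le order_refl)
        then obtain n where n: "g (Suc n) \<le> d" "\<not> g n \<le> d"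
          using ex_least_nat_less[of "\<lambda>n. g n \<le> d" m] small
          by (auto simp: d_def not_le)
        have "\<mu> n \<le> C * g (Suc n) powr s"
          by (rule \<mu>_le)
        also have "\<dots> \<le> C * d powr s"
          using n C1 s g_pos[of "Suc n"] by (intro mult_left_mono powr_mono2) auto
        finally show ?thesis
          using n False by (intro exI[of _ n]) auto
      qed
      then obtain n where n: "d < g n" "\<mu> n \<le> C * (if s = 0 then 1 else d powr s)"
        by blast
      have "ennreal (\<mu> n) \<le> ennreal (C * (if s = 0 then 1 else d powr s))"
        using n by (intro ennreal_leI)
      also have "\<dots> = ennreal C * diam_power s V"
        using C1 \<omega>(2) by (auto simp: diam_power_def d_def ennreal_mult)
      finally show ?thesis
        using sub[OF n(1)] cyl[OF \<omega>(1), of n] by (intro bexI[of _ "cyl n \<omega>"]) auto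
    next
      case False
      \<comment> \<open>A single point lies in cylinders of every depth, so its mass is at most every \<open>\<mu> n\<close>.\<close>
      then have "d = 0" "0 < s"
        using d s by auto
      define B where "B = (\<Inter>n. cyl n \<omega>)"
      have B: "B \<in> sets ?P"
        unfolding B_def using cyl[OF \<omega>(1)] by (intro sets.countable_INT) auto
      have "emeasure ?P B \<le> ennreal (C * g (Suc n) powr s)" for n
      proof -
        have "emeasure ?P B \<le> emeasure ?P (cyl n \<omega>)"
          using cyl[OF \<omega>(1), of n] by (intro emeasure_mono) (auto simp: B_def)
        also have "\<dots> = ennreal (\<mu> n)"
          using cyl[OF \<omega>(1), of n] by simp
        also have "\<dots> \<le> ennreal (C * g (Suc n) powr s)"
          by (intro ennreal_leI \<mu>_le)
        finally show ?thesis .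
      qed
      moreover have "(\<lambda>n. ennreal (C * g (Suc n) powr s)) \<longlonglongrightarrow> ennreal (C * 0)"
        using \<open>0 < s\<close> g_pos
        by (intro tendsto_ennrealI tendsto_mult tendsto_const tendsto_zero_powrI[of _ _ _ s] LIMSEQ_Suc g_lim)
          (auto simp: less_imp_le[OF g_pos])
      ultimately have "emeasure ?P B \<le> ennreal (C * 0)"
        by (intro LIMSEQ_le_const) auto
      then have "emeasure ?P B \<le> ennreal C * diam_power s V"
        by simp
      moreover have "{\<omega>\<in>\<Omega>. X \<omega> \<in> V} \<subseteq> B"
        using sub g_pos \<open>d = 0\<close> by (auto simp: B_def)
      ultimately show ?thesis
        using B by blast
    qed
  qed

  have "hausdorff_content s (1 / 4) E \<le> hausdorff_measure s E"
    unfolding hausdorff_measure_def by (rule SUP_upper) simp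
  also have "\<dots> < ennreal (1 / C)"
    using zero C1 by simp
  finally obtain U where U: "E \<subseteq> (\<Union>n. U n)" "\<And>n. bounded (U n) \<and> diameter (U n) \<le> 1 / 4"
      "(\<Sum>n. diam_power s (U n)) < ennreal (1 / C)"
    by (rule hausdorff_content_near_cover) (rule that)
  have small: "diameter (U n) < g 0" for n
    using U(2)[of n] by (simp add: g_def)
  have "\<exists>B. B \<in> sets ?P \<and> {\<omega>\<in>\<Omega>. X \<omega> \<in> U n} \<subseteq> B \<and> emeasure ?P B \<le> ennreal C * diam_power s (U n)"
    for n
    using mass[of "U n"] small U(2) by blast
  then obtain B where B: "\<And>n. B n \<in> sets ?P" "\<And>n. {\<omega>\<in>\<Omega>. X \<omega> \<in> U n} \<subseteq> B n"
      "\<And>n. emeasure ?P (B n) \<le> ennreal C * diam_power s (U n)"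
    using that choice[of "\<lambda>n B. B \<in> sets ?P \<and> {\<omega>\<in>\<Omega>. X \<omega> \<in> U n} \<subseteq> B
      \<and> emeasure ?P B \<le> ennreal C * diam_power s (U n)"] by blast
  have "\<Omega> \<subseteq> (\<Union>n. B n)"
  proof
    fix \<omega>
    assume \<omega>: "\<omega> \<in> \<Omega>"
    then obtain n where "X \<omega> \<in> U n"
      using X_E U(1) by blast
    with \<omega> B(2) show "\<omega> \<in> (\<Union>n. B n)"
      by blast
  qed
  then have "emeasure ?P (space ?P) \<le> emeasure ?P (\<Union>n. B n)"
    unfolding space_P using B(1) by (intro emeasure_mono) auto
  also have "\<dots> \<le> (\<Sum>n. emeasure ?P (B n))"
    using B(1) by (intro emeasure_subadditive_countably) auto
  also have "\<dots> \<le> (\<Sum>n. ennreal C * diam_power s (U n))"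
    by (intro suminf_le B(3)) auto
  also have "\<dots> = ennreal C * (\<Sum>n. diam_power s (U n))"
    by (rule ennreal_suminf_cmult)
  also have "\<dots> < ennreal C * ennreal (1 / C)"
    using U(3) C1 by (intro ennreal_mult_strict_left_mono) auto
  also have "\<dots> = 1"
    using C1 by (simp flip: ennreal_mult)
  finally show False
    by (simp add: P.emeasure_space_1)
qed

section \<open>Growth of the exponent\<close>

lemma square_div_bounds:
  fixes q i :: nat
  assumes "1 \<le> q"
  shows "(i\<^sup>2 div q\<^sup>2) * q\<^sup>2 \<le> i\<^sup>2" "i\<^sup>2 < (i\<^sup>2 div q\<^sup>2 + 1) * q\<^sup>2"
proof -
  have q2: "0 < q\<^sup>2"
    using assms by simp
  show "(i\<^sup>2 div q\<^sup>2) * q\<^sup>2 \<le> i\<^sup>2" "i\<^sup>2 < (i\<^sup>2 div q\<^sup>2 + 1) * q\<^sup>2"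
    using div_mult_mod_eq[of "i\<^sup>2" "q\<^sup>2"] mod_less_divisor[OF q2, of "i\<^sup>2"] by (linarith, simp)
qed

text \<open>
  The points \<open>j\<^sup>2 div q\<^sup>2\<close> cut every block \<open>{m\<^sup>2..(m + 1)\<^sup>2}\<close> into \<open>q\<close> pieces on which
  \<open>sqrt\<close> grows by about \<open>1 / q\<close>.  The cut points include all squares.
\<close>

lemma sqrt_cut_points:
  fixes q :: nat
  assumes q: "1 \<le> q"
  shows "\<forall>\<^sub>F j in sequentially. sqrt (real (j\<^sup>2 div q\<^sup>2)) \<le> real j / real q
    \<and> real j / real q + 3 / (4 * real q) \<le> sqrt (real ((Suc j)\<^sup>2 div q\<^sup>2))"
proof -
  have bounds: "real (i\<^sup>2 div q\<^sup>2) \<le> (real i / real q)\<^sup>2 \<and> (real i / real q)\<^sup>2 - 1 \<le> real (i\<^sup>2 div q\<^sup>2)"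
    for i
  proof -
    have "real ((i\<^sup>2 div q\<^sup>2) * q\<^sup>2) \<le> real (i\<^sup>2)" "real (i\<^sup>2) < real ((i\<^sup>2 div q\<^sup>2 + 1) * q\<^sup>2)"
      by (simp_all only: of_nat_le_iff of_nat_less_iff square_div_bounds[OF q])
    then show ?thesis
      using q by (simp add: power_divide pos_le_divide_eq pos_divide_le_eq algebra_simps)
  qed
  have "\<forall>\<^sub>F j in sequentially. 4 * q\<^sup>2 \<le> j"
    by (rule eventually_ge_at_top)
  then show ?thesis
  proof eventually_elim
    case (elim j)
    \<comment> \<open>Rounding costs at most \<open>1\<close> under the root, and \<open>sqrt (y\<^sup>2 - 1) \<ge> y - 1 / y\<close>.\<close>
    define y where "y = real (Suc j) / real q"
    have "4 * q\<^sup>2 \<le> Suc j"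
      using elim by simp
    then have "real (4 * q\<^sup>2) \<le> real (Suc j)"
      by (rule of_nat_mono)
    then have "4 * real q \<le> y"
      using q by (simp add: y_def pos_le_divide_eq power2_eq_square)
    moreover have "4 \<le> 4 * real q"
      using q by simp
    ultimately have y: "4 * real q \<le> y" "1 \<le> y"
      by linarith+
    then have inv: "1 / y \<le> 1 / (4 * real q)" "1 / y \<le> 1"
      using q by (auto intro: divide_left_mono)
    have "(y - 1 / y)\<^sup>2 = y\<^sup>2 - 2 + (1 / y)\<^sup>2"
      using y by (simp add: power2_diff)
    moreover have "(1 / y)\<^sup>2 \<le> 1"
      using inv y by (intro power_le_one) auto
    ultimately have "y - 1 / y \<le> sqrt (y\<^sup>2 - 1)"
      by (intro real_le_rsqrt) linarith
    moreover have "y = real j / real q + 1 / real q"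
      by (simp add: y_def add_divide_distrib)
    moreover have "1 / real q = 3 / (4 * real q) + 1 / (4 * real q)"
      using q by (simp add: field_simps)
    ultimately have lower: "real j / real q + 3 / (4 * real q) \<le> sqrt (y\<^sup>2 - 1)"
      using inv by linarith
    have "sqrt (real (j\<^sup>2 div q\<^sup>2)) \<le> sqrt ((real j / real q)\<^sup>2)"
      using bounds by (intro real_sqrt_le_mono) auto
    then have "sqrt (real (j\<^sup>2 div q\<^sup>2)) \<le> real j / real q"
      by simp
    moreover have "sqrt (y\<^sup>2 - 1) \<le> sqrt (real ((Suc j)\<^sup>2 div q\<^sup>2))"
      unfolding y_def by (intro real_sqrt_le_mono conjunct2[OF bounds])
    ultimately show ?case
      using lower by (intro conjI; linarith)
  qed
qed

lemma cut_point_gap: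
  fixes q j :: nat
  assumes q: "1 \<le> q"
  shows "real ((Suc j)\<^sup>2 div q\<^sup>2 - j\<^sup>2 div q\<^sup>2) \<le> (2 * real j + 1) / (real q)\<^sup>2 + 1" (is ?gap)
    and "real ((Suc j)\<^sup>2 div q\<^sup>2 - j\<^sup>2 div q\<^sup>2) \<le> 2 * real j + 2"
proof -
  have "real (j\<^sup>2) \<le> real ((j\<^sup>2 div q\<^sup>2 + 1) * q\<^sup>2)" "real (((Suc j)\<^sup>2 div q\<^sup>2) * q\<^sup>2) \<le> real ((Suc j)\<^sup>2)"
    by (simp_all only: of_nat_le_iff less_imp_le square_div_bounds[OF q])
  then have "(real ((Suc j)\<^sup>2 div q\<^sup>2) - real (j\<^sup>2 div q\<^sup>2)) * (real q)\<^sup>2 \<le> 2 * real j + 1 + (real q)\<^sup>2"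
    by (simp add: algebra_simps power2_eq_square)
  then have "real ((Suc j)\<^sup>2 div q\<^sup>2) - real (j\<^sup>2 div q\<^sup>2) \<le> (2 * real j + 1 + (real q)\<^sup>2) / (real q)\<^sup>2"
    using q by (simp add: pos_le_divide_eq)
  moreover have "j\<^sup>2 div q\<^sup>2 \<le> (Suc j)\<^sup>2 div q\<^sup>2"
    by (intro div_le_mono power_mono) auto
  ultimately show ?gap
    using q by (simp add: of_nat_diff add_divide_distrib)
  moreover have "(2 * real j + 1) / (real q)\<^sup>2 \<le> (2 * real j + 1) / 1"
    using q by (intro divide_left_mono) auto
  ultimately show "real ((Suc j)\<^sup>2 div q\<^sup>2 - j\<^sup>2 div q\<^sup>2) \<le> 2 * real j + 2"
    by simp
qed

lemma cut_points_at_top: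
  fixes q :: nat
  assumes q: "1 \<le> q"
  shows "filterlim (\<lambda>j. j\<^sup>2 div q\<^sup>2) at_top sequentially"
  unfolding filterlim_at_top
proof
  fix Z
  show "\<forall>\<^sub>F j in sequentially. Z \<le> j\<^sup>2 div q\<^sup>2"
    using eventually_ge_at_top[of "Z * q"]
  proof eventually_elim
    case (elim j)
    have "(Z * q)\<^sup>2 div q\<^sup>2 \<le> j\<^sup>2 div q\<^sup>2"
      using elim by (intro div_le_mono power_mono) auto
    moreover have "(Z * q)\<^sup>2 div q\<^sup>2 = Z\<^sup>2"
      using q by (simp add: power_mult_distrib)
    moreover have "Z \<le> Z\<^sup>2"
      by (simp add: power2_eq_square)
    ultimately show ?case
      by linarith
  qed
qed

text \<open>
  The perturbation enters only through its values at natural numbers and through a bound \<open>osc m\<close> on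
  its oscillation over the block \<open>{m\<^sup>2..(m + 1)\<^sup>2}\<close>.  Both endpoints belong to the block, so
  consecutive blocks can be chained.
\<close>

locale block_constant_perturbation =
  fixes c :: real and r :: "nat \<Rightarrow> real" and osc :: "nat \<Rightarrow> real"
  assumes c_pos: "0 < c"
    and exponent_mono: "\<And>m n. 1 \<le> m \<Longrightarrow> m \<le> n \<Longrightarrow> c * sqrt (real m) + r m \<le> c * sqrt (real n) + r n"
    and osc_bound: "\<And>m k. m\<^sup>2 \<le> k \<Longrightarrow> k \<le> (m + 1)\<^sup>2 \<Longrightarrow> \<bar>r k - r (m\<^sup>2)\<bar> \<le> osc m"
    and osc_lim: "osc \<longlonglongrightarrow> 0"
begin

definition exponent :: "nat \<Rightarrow> real" where
  "exponent n = c * sqrt (real n) + r n"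

lemma exponent_le: "1 \<le> m \<Longrightarrow> m \<le> n \<Longrightarrow> exponent m \<le> exponent n"
  unfolding exponent_def by (rule exponent_mono)

lemma eventually_block_variation:
  assumes "0 < \<epsilon>"
  shows "\<forall>\<^sub>F m in sequentially. \<forall>k k'. m\<^sup>2 \<le> k \<longrightarrow> k \<le> (m + 1)\<^sup>2 \<longrightarrow> m\<^sup>2 \<le> k' \<longrightarrow> k' \<le> (m + 1)\<^sup>2
    \<longrightarrow> \<bar>r k' - r k\<bar> \<le> \<epsilon>"
proof -
  have "\<forall>\<^sub>F m in sequentially. osc m < \<epsilon> / 2"
    using osc_lim assms by (intro order_tendstoD) auto
  then show ?thesis
  proof eventually_elim
    case (elim m)
    show ?case
    proof (intro allI impI)
      fix k k'
      assume "m\<^sup>2 \<le> k" "k \<le> (m + 1)\<^sup>2" "m\<^sup>2 \<le> k'" "k' \<le> (m + 1)\<^sup>2"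
      then show "\<bar>r k' - r k\<bar> \<le> \<epsilon>"
        using osc_bound[of m k] osc_bound[of m k'] elim by linarith
    qed
  qed
qed

text \<open>
  The increments of the exponent between consecutive squares tend to \<open>c\<close>, and are thus eventually at
  least \<open>3 c / 4\<close>; monotonicity fills in the other indices, and a slope below \<open>3 c / 4\<close> absorbs all constants.
\<close>

lemma exponent_lower: "\<forall>\<^sub>F n in sequentially. c / 2 * sqrt (real n) \<le> exponent n"
proof -
  obtain M where M: "\<And>m k k'. m \<ge> M \<Longrightarrow> m\<^sup>2 \<le> k \<Longrightarrow> k \<le> (m + 1)\<^sup>2 \<Longrightarrow> m\<^sup>2 \<le> k' \<Longrightarrow> k' \<le> (m + 1)\<^sup>2
      \<Longrightarrow> \<bar>r k' - r k\<bar> \<le> c / 4"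
    using eventually_block_variation[of "c / 4"] c_pos unfolding eventually_sequentially by auto
  have squares: "exponent (M\<^sup>2) + 3 * c / 4 * (real m - real M) \<le> exponent (m\<^sup>2)" if "m \<ge> M" for m
    using that
  proof (induction m rule: dec_induct)
    case (step m)
    have "\<bar>r ((Suc m)\<^sup>2) - r (m\<^sup>2)\<bar> \<le> c / 4"
      using step by (intro M[of m]) (auto simp: power2_eq_square)
    then have "r (m\<^sup>2) - c / 4 \<le> r ((Suc m)\<^sup>2)"
      by linarith
    moreover have "exponent (k\<^sup>2) = c * real k + r (k\<^sup>2)" for k
      by (simp add: exponent_def)
    ultimately have "exponent (m\<^sup>2) + 3 * c / 4 \<le> exponent ((Suc m)\<^sup>2)"
      by (simp add: algebra_simps)
    moreover have "3 * c / 4 * (real (Suc m) - real M) = 3 * c / 4 * (real m - real M) + 3 * c / 4"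
      by (simp add: field_simps)
    ultimately show ?case
      using step.IH by linarith
  qed simp
  define K where "K = exponent (M\<^sup>2) - 3 * c / 4 * (1 + real M)"
  have "\<forall>\<^sub>F n in sequentially. c / 2 * sqrt (real n) \<le> 3 * c / 4 * sqrt (real n) + K"
    using c_pos by real_asymp
  moreover have "\<forall>\<^sub>F n in sequentially. n \<ge> (M + 1)\<^sup>2"
    by (rule eventually_ge_at_top)
  ultimately show ?thesis
  proof eventually_elim
    case (elim n)
    define m where "m = floor_sqrt n"
    have m: "M + 1 \<le> m"
      unfolding m_def using elim(2) by (rule le_floor_sqrtI)
    have "sqrt (real n) \<le> sqrt (real ((Suc m)\<^sup>2))"
      using Suc_floor_sqrt_power2_gt[of n] unfolding m_def
      by (intro real_sqrt_le_mono of_nat_mono less_imp_le)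
    then have "sqrt (real n) \<le> real m + 1"
      by simp
    then have "3 * c / 4 * sqrt (real n) \<le> 3 * c / 4 * (real m + 1)"
      using c_pos by (intro mult_left_mono) auto
    moreover have "3 * c / 4 * (real m - real M) = 3 * c / 4 * (real m + 1) - 3 * c / 4 * (1 + real M)"
      by (simp add: field_simps)
    ultimately have "3 * c / 4 * sqrt (real n) + K \<le> exponent (m\<^sup>2)"
      using squares[of m] m unfolding K_def by linarith
    also have "\<dots> \<le> exponent n"
    proof (rule exponent_le)
      show "1 \<le> m\<^sup>2"
        using m by (simp add: Suc_le_eq)
      show "m\<^sup>2 \<le> n"
        by (simp add: m_def)
    qed
    finally show ?case
      using elim(1) by simp
  qed
qed

lemma exponent_Suc: "\<forall>\<^sub>F n in sequentially. exponent (Suc n) \<le> exponent n + (c + 1)"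
proof -
  obtain M where M: "\<And>m k k'. m \<ge> M \<Longrightarrow> m\<^sup>2 \<le> k \<Longrightarrow> k \<le> (m + 1)\<^sup>2 \<Longrightarrow> m\<^sup>2 \<le> k' \<Longrightarrow> k' \<le> (m + 1)\<^sup>2
      \<Longrightarrow> \<bar>r k' - r k\<bar> \<le> 1"
    using eventually_block_variation[of 1] unfolding eventually_sequentially by auto
  have "\<forall>\<^sub>F n in sequentially. n \<ge> M\<^sup>2"
    by (rule eventually_ge_at_top)
  then show ?thesis
  proof eventually_elim
    case (elim n)
    have "\<bar>r (Suc n) - r n\<bar> \<le> 1"
      using elim Suc_floor_sqrt_power2_gt[of n]
      by (intro M[of "floor_sqrt n"]) (auto intro: le_floor_sqrtI le_SucI)
    moreover have "c * sqrt (real (Suc n)) \<le> c * (sqrt (real n) + 1)"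
      using c_pos sqrt_add_le_add_sqrt[of "real n" 1] by (intro mult_left_mono) (auto simp: add.commute)
    ultimately show ?case
      by (simp add: exponent_def algebra_simps abs_le_iff)
  qed
qed

text \<open>No piece straddles a square, so the perturbation hardly changes along it.\<close>

lemma exponent_cut_points:
  fixes q :: nat
  assumes q: "1 \<le> q"
  shows "\<forall>\<^sub>F j in sequentially. exponent (j\<^sup>2 div q\<^sup>2) + c / (2 * real q) \<le> exponent ((Suc j)\<^sup>2 div q\<^sup>2)"
proof -
  have "0 < c / (4 * real q)"
    using c_pos q by simp
  then obtain M where M: "\<And>m k k'. m \<ge> M \<Longrightarrow> m\<^sup>2 \<le> k \<Longrightarrow> k \<le> (m + 1)\<^sup>2 \<Longrightarrow> m\<^sup>2 \<le> k' \<Longrightarrow> k' \<le> (m + 1)\<^sup>2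
      \<Longrightarrow> \<bar>r k' - r k\<bar> \<le> c / (4 * real q)"
    using eventually_block_variation[of "c / (4 * real q)"] unfolding eventually_sequentially by auto
  have "\<forall>\<^sub>F j in sequentially. j \<ge> M * q"
    by (rule eventually_ge_at_top)
  with sqrt_cut_points[OF q] show ?thesis
  proof eventually_elim
    case (elim j)
    define m where "m = j div q"
    have "q > 0"
      using q by simp
    then have m: "M \<le> m" "q * m \<le> j" "Suc j \<le> q * (m + 1)"
      using elim dividend_less_times_div[of q j]
      by (auto simp: m_def less_eq_div_iff_mult_less_eq Suc_le_eq)
    have range: "m\<^sup>2 \<le> i\<^sup>2 div q\<^sup>2 \<and> i\<^sup>2 div q\<^sup>2 \<le> (m + 1)\<^sup>2" if "q * m \<le> i" "i \<le> q * (m + 1)" for i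
    proof
      have "(q * m)\<^sup>2 div q\<^sup>2 \<le> i\<^sup>2 div q\<^sup>2" "i\<^sup>2 div q\<^sup>2 \<le> (q * (m + 1))\<^sup>2 div q\<^sup>2"
        using that by (intro div_le_mono power_mono; simp)+
      moreover have "(q * k)\<^sup>2 div q\<^sup>2 = k\<^sup>2" for k
        using \<open>q > 0\<close> by (simp add: power_mult_distrib)
      ultimately show "m\<^sup>2 \<le> i\<^sup>2 div q\<^sup>2" "i\<^sup>2 div q\<^sup>2 \<le> (m + 1)\<^sup>2"
        by (simp_all only:)
    qed
    have "\<bar>r ((Suc j)\<^sup>2 div q\<^sup>2) - r (j\<^sup>2 div q\<^sup>2)\<bar> \<le> c / (4 * real q)"
      using m range[of j] range[of "Suc j"] by (intro M[of m]) auto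
    moreover have "c * sqrt (real (j\<^sup>2 div q\<^sup>2)) \<le> c * (real j / real q)"
      "c * (real j / real q + 3 / (4 * real q)) \<le> c * sqrt (real ((Suc j)\<^sup>2 div q\<^sup>2))"
      using elim c_pos by (intro mult_left_mono; simp)+
    moreover have "c * (real j / real q + 3 / (4 * real q)) = c * (real j / real q) + 3 * (c / (4 * real q))"
      "c / (2 * real q) = 2 * (c / (4 * real q))"
      by (simp_all add: algebra_simps)
    ultimately show ?case
      unfolding exponent_def by linarith
  qed
qed

section \<open>The upper bound\<close>

text \<open>
  Write \<open>\<phi> = exp \<circ> exponent\<close>.  Over a piece \<open>\<phi>\<close> grows at least by the factor \<open>1 / \<theta>\<close>, so the digit sum has to gain a fixed proportion
  of \<open>\<phi>\<close> there.  The piece has only \<open>O(j)\<close> digits, too few to produce this gain unless one of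
  them is exponentially large in \<open>j\<close>.
\<close>

lemma eventually_large_digit:
  fixes q :: nat
  assumes q: "1 \<le> q"
    and sum_lim: "(\<lambda>n. real (cf_sum x n) / exp (exponent n)) \<longlonglongrightarrow> 1"
  shows "\<forall>\<^sub>F j in sequentially. \<exists>k\<in>{j\<^sup>2 div q\<^sup>2<..(Suc j)\<^sup>2 div q\<^sup>2}.
    exp (c / (4 * real q) * real j) \<le> real (cf_coeff x k)"
proof -
  let ?n = "\<lambda>j. j\<^sup>2 div q\<^sup>2"
  let ?M = "\<lambda>j. exp (c / (4 * real q) * real j)"
  define \<theta> where "\<theta> = exp (- c / (2 * real q))"
  \<comment> \<open>Relative error allowed in \<open>S \<approx> \<phi>\<close>; it is chosen so that \<open>(1 - \<eta>) - (\<theta> + \<eta>) = 2 * \<eta>\<close>.\<close>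
  define \<eta> where "\<eta> = (1 - \<theta>) / 4"
  have \<theta>: "0 < \<theta>" "\<theta> < 1"
    using c_pos q by (auto simp: \<theta>_def)
  then have \<eta>: "0 < \<eta>"
    by (simp add: \<eta>_def)
  have at_top: "filterlim ?n at_top sequentially" "filterlim (\<lambda>j. ?n (Suc j)) at_top sequentially"
    using cut_points_at_top[OF q] filterlim_compose[OF cut_points_at_top[OF q] filterlim_Suc] by auto
  have "\<forall>\<^sub>F n in sequentially. dist (real (cf_sum x n) / exp (exponent n)) 1 < \<eta>"
    using sum_lim \<eta> by (rule tendstoD)
  then have ratio: "\<forall>\<^sub>F j in sequentially. dist (real (cf_sum x (?n j)) / exp (exponent (?n j))) 1 < \<eta>"
      "\<forall>\<^sub>F j in sequentially. dist (real (cf_sum x (?n (Suc j))) / exp (exponent (?n (Suc j)))) 1 < \<eta>"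
    using at_top by (auto dest: eventually_compose_filterlim)
  have lower: "\<forall>\<^sub>F j in sequentially. c / 2 * sqrt (real (?n (Suc j))) \<le> exponent (?n (Suc j))"
    using exponent_lower at_top(2) by (rule eventually_compose_filterlim)
  have D: "0 < c / (4 * real q)"
    using c_pos q by simp
  have "\<forall>\<^sub>F j in sequentially. (2 * real j + 2) * exp (D * real j) < 2 * \<eta> * exp (2 * D * real j)"
    if "D > 0" for D :: real
    using that \<eta> by real_asymp
  from this[OF D] have
    "\<forall>\<^sub>F j in sequentially. (2 * real j + 2) * ?M j < 2 * \<eta> * exp (2 * (c / (4 * real q)) * real j)" .
  with ratio lower exponent_cut_points[OF q] sqrt_cut_points[OF q] show ?thesis
  proof eventually_elim
    case (elim j)
    let ?S = "\<lambda>j. real (cf_sum x (?n j))" and ?p = "\<lambda>j. exp (exponent (?n j))"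
    have le: "?n j \<le> ?n (Suc j)"
      by (intro div_le_mono power_mono) auto
    have S: "?S j \<le> (1 + \<eta>) * ?p j" "(1 - \<eta>) * ?p (Suc j) \<le> ?S (Suc j)"
      using elim(1,2) by (auto simp: dist_real_def abs_less_iff field_simps)
    have "?p j \<le> exp (exponent (?n (Suc j)) - c / (2 * real q))"
      using elim(4) by simp
    also have "\<dots> = \<theta> * ?p (Suc j)"
      by (simp add: \<theta>_def exp_diff exp_minus field_simps)
    finally have p: "?p j \<le> \<theta> * ?p (Suc j)" .
    have "(1 + \<eta>) * ?p j \<le> (1 + \<eta>) * (\<theta> * ?p (Suc j))"
      using \<eta> p by (intro mult_left_mono) auto
    also have "\<dots> \<le> (\<theta> + \<eta>) * ?p (Suc j)"
    proof -
      have "\<eta> * \<theta> \<le> \<eta>"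
        using \<eta> \<theta> by simp
      then have "(1 + \<eta>) * \<theta> \<le> \<theta> + \<eta>"
        by (simp add: algebra_simps)
      then have "((1 + \<eta>) * \<theta>) * ?p (Suc j) \<le> (\<theta> + \<eta>) * ?p (Suc j)"
        by (intro mult_right_mono) auto
      then show ?thesis
        by (simp only: mult.assoc)
    qed
    finally have "(1 - \<eta>) * ?p (Suc j) - (\<theta> + \<eta>) * ?p (Suc j) \<le> ?S (Suc j) - ?S j"
      using S by linarith
    moreover have "(1 - \<eta>) * ?p (Suc j) - (\<theta> + \<eta>) * ?p (Suc j) = 2 * \<eta> * ?p (Suc j)"
      by (simp add: \<eta>_def field_simps)
    ultimately have gain: "2 * \<eta> * ?p (Suc j) \<le> ?S (Suc j) - ?S j"
      by simp
    show ?case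
    proof (rule ccontr)
      assume "\<not> ?thesis"
      then have small: "real (cf_coeff x k) \<le> ?M j" if "k \<in> {?n j<..?n (Suc j)}" for k
        using that by (auto simp: not_le intro: less_imp_le)
      have "?S (Suc j) - ?S j = (\<Sum>k\<in>{?n j<..?n (Suc j)}. real (cf_coeff x k))"
      proof -
        have "{1..?n (Suc j)} = {1..?n j} \<union> {?n j<..?n (Suc j)}"
          using le by auto
        then have "cf_sum x (?n (Suc j)) = cf_sum x (?n j) + (\<Sum>k\<in>{?n j<..?n (Suc j)}. cf_coeff x k)"
          unfolding cf_sum_def by (simp only:) (rule sum.union_disjoint, auto)
        then show ?thesis
          by simp
      qed
      also have "\<dots> \<le> (\<Sum>k\<in>{?n j<..?n (Suc j)}. ?M j)"
        by (intro sum_mono small)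
      also have "\<dots> = real (?n (Suc j) - ?n j) * ?M j"
        by simp
      also have "\<dots> \<le> (2 * real j + 2) * ?M j"
        by (intro mult_right_mono cut_point_gap(2)[OF q]) auto
      also have "\<dots> < 2 * \<eta> * exp (2 * (c / (4 * real q)) * real j)"
        by (rule elim)
      also have "\<dots> \<le> 2 * \<eta> * ?p (Suc j)"
      proof -
        have "real j / real q \<le> sqrt (real (?n (Suc j)))"
          using elim(5) q by (auto intro: order_trans[rotated])
        then have "c / 2 * (real j / real q) \<le> c / 2 * sqrt (real (?n (Suc j)))"
          using c_pos by (intro mult_left_mono) auto
        also have "\<dots> \<le> exponent (?n (Suc j))"
          by (rule elim)
        finally have "2 * (c / (4 * real q)) * real j \<le> exponent (?n (Suc j))"
          by (simp add: field_simps)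
        then show ?thesis
          using \<eta> by simp
      qed
      finally show False
        using gain by linarith
    qed
  qed
qed

text \<open>
  With \<open>q\<close> pieces per block the \<open>j\<close>-th piece has about \<open>2 j / q\<^sup>2\<close> digits, which cost
  \<open>exp (2 j * ln Z / q\<^sup>2)\<close>, while its large digit gains \<open>exp (- (s - 1 / 2) * c * j / (4 q))\<close>.
  The gain wins once \<open>q\<close> exceeds \<open>8 * ln Z / ((s - 1 / 2) * c)\<close>.
\<close>

lemma hausdorff_measure_cf_sum_zero:
  assumes s: "1 / 2 < s"
    and E: "E \<subseteq> unit_irrationals"
    and sum_lim: "\<And>x. x \<in> E \<Longrightarrow> (\<lambda>n. real (cf_sum x n) / exp (exponent n)) \<longlonglongrightarrow> 1"
  shows "hausdorff_measure s E = 0"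
proof -
  define \<sigma> where "\<sigma> = s - 1 / 2"
  have \<sigma>: "0 < \<sigma>"
    using s by (simp add: \<sigma>_def)
  define Z where "Z = enn2real (digit_zeta (s + 1 / 2))"
  have Z_eq: "digit_zeta (s + 1 / 2) = ennreal Z"
    using digit_zeta_finite[of "s + 1 / 2"] s by (simp add: Z_def)
  have Z: "1 \<le> Z"
    using digit_zeta_ge_1[of "s + 1 / 2"] unfolding Z_eq by simp
  obtain q' :: nat where q': "8 * ln Z / (\<sigma> * c) < real q'"
    using reals_Archimedean2 by blast
  define q where "q = Suc q'"
  have q: "1 \<le> q" "8 * ln Z / (\<sigma> * c) < real q"
    using q' by (auto simp: q_def)
  define D where "D = \<sigma> * (c / (4 * real q)) - 2 * ln Z / (real q)\<^sup>2"
  have D: "0 < D"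
  proof -
    have "8 * ln Z < real q * (\<sigma> * c)"
      using q(2) \<sigma> c_pos by (simp add: pos_divide_less_eq)
    then have "0 < (real q * (\<sigma> * c) - 8 * ln Z) / (4 * (real q)\<^sup>2)"
      using q by (intro divide_pos_pos) auto
    also have "\<dots> = D"
      using q by (simp add: D_def field_simps power2_eq_square)
    finally show ?thesis .
  qed
  define K where "K = ln Z / (real q)\<^sup>2 + ln Z"
  define n where "n j = j\<^sup>2 div q\<^sup>2" for j :: nat
  define M where "M j = exp (c / (4 * real q) * real j)" for j :: nat
  have "\<forall>\<^sub>F j in sequentially. (2 * real j + 2) * exp (K - D * real j) \<le> 1 / 2"
    using D by real_asymp
  then have small: "\<forall>\<^sub>F j in sequentially. real (n (Suc j) - n j) * M j powr - \<sigma> * Z ^ (n (Suc j) - n j) \<le> 1 / 2"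
  proof eventually_elim
    case (elim j)
    let ?l = "n (Suc j) - n j"
    have gap: "real ?l \<le> (2 * real j + 1) / (real q)\<^sup>2 + 1"
      and l: "real ?l \<le> 2 * real j + 2"
      unfolding n_def by (rule cut_point_gap[OF q(1)])+
    have Mpow: "M j powr - \<sigma> = exp (- \<sigma> * (c / (4 * real q) * real j))"
      by (simp add: M_def powr_def)
    have "Z ^ ?l = exp (real ?l * ln Z)"
      using Z by (simp add: exp_of_nat_mult)
    also have "\<dots> \<le> exp (((2 * real j + 1) / (real q)\<^sup>2 + 1) * ln Z)"
      using gap Z by (intro exp_le_cancel_iff[THEN iffD2] mult_right_mono) auto
    finally have "M j powr - \<sigma> * Z ^ ?l \<le> M j powr - \<sigma> * exp (((2 * real j + 1) / (real q)\<^sup>2 + 1) * ln Z)"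
      by (intro mult_left_mono) auto
    also have "\<dots> = exp (K - D * real j)"
      by (simp add: Mpow K_def D_def add_divide_distrib algebra_simps flip: exp_add)
    finally have "real ?l * (M j powr - \<sigma> * Z ^ ?l) \<le> (2 * real j + 2) * exp (K - D * real j)"
      using l Z by (intro mult_mono) auto
    with elim show ?case
      by (simp only: mult.assoc)
  qed
  show ?thesis
  proof (rule hausdorff_measure_zero_of_large_digit_blocks[OF s, where n = n and M = M])
    show "mono n"
      unfolding n_def by (intro monoI div_le_mono power_mono) auto
    show "0 < M j" for j
      by (simp add: M_def)
    show "\<forall>\<^sub>F j in sequentially. of_nat (n (Suc j) - n j) * ennreal (M j powr - (s - 1 / 2))
        * digit_zeta (s + 1 / 2) ^ (n (Suc j) - n j) \<le> ennreal (1 / 2)"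
      using small
    proof eventually_elim
      case (elim j)
      have "of_nat (n (Suc j) - n j) * ennreal (M j powr - (s - 1 / 2)) * digit_zeta (s + 1 / 2) ^ (n (Suc j) - n j)
        = ennreal (real (n (Suc j) - n j) * M j powr - \<sigma> * Z ^ (n (Suc j) - n j))"
        using Z by (simp add: Z_eq \<sigma>_def ennreal_mult ennreal_power flip: ennreal_of_nat_eq_real_of_nat)
      with elim show ?case
        by (simp add: ennreal_leI del: ennreal_half)
    qed
    show "\<forall>\<^sub>F j in sequentially. \<exists>k\<in>{n j<..n (Suc j)}. M j \<le> real (cf_coeff x k)" if "x \<in> E" for x
      unfolding n_def M_def by (rule eventually_large_digit[OF q(1) sum_lim[OF that]])
  qed (rule E)
qed

section \<open>The lower bound\<close>

text \<open>
  Write \<open>\<phi> = exp \<circ> exponent\<close>.  The digits follow the increments of \<open>\<phi>\<close>, which may be zero, plus an offset of order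
  \<open>\<phi> k / k\<^sup>2\<close> that provides the freedom of choice.  The summable weight \<open>1 / k\<^sup>2\<close> makes the offsets
  negligible against \<open>\<phi> n\<close> by Tannery's theorem, yet it is polynomial and does not affect the dimension.
\<close>

lemma hausdorff_measure_cf_sum_nonzero:
  assumes s: "0 \<le> s" "s < 1 / 2"
    and E: "{x \<in> unit_irrationals. (\<lambda>n. real (cf_sum x n) / exp (exponent n)) \<longlonglongrightarrow> 1} \<subseteq> E"
  shows "hausdorff_measure s E \<noteq> 0"
proof -
  \<comment> \<open>Position \<open>k\<close> refers to the digit with index \<open>k + 1\<close>; the first increment is \<open>\<phi> 1\<close> itself.\<close>
  define p where "p k = exp (exponent (Suc k))" for k
  define d where "d k = p k - (if k = 0 then 0 else p (k - 1))" for k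
  define w where "w k = 1 / (real (Suc k))\<^sup>2" for k
  define N where "N k = nat \<lceil>p k * w k\<rceil>" for k
  define L where "L k = nat \<lfloor>d k\<rfloor> + N k + 1" for k
  have p_pos: "0 < p k" for k
    by (simp add: p_def)
  have p_mono: "p k \<le> p n" if "k \<le> n" for k n
    using that by (simp add: p_def exponent_le)
  have w_pos: "0 < w k" for k
    by (simp add: w_def)
  have w_le: "w k \<le> 1" for k
    by (simp add: w_def)
  have d_nonneg: "0 \<le> d k" and d_le: "d k \<le> p k" for k
    using p_mono[of "k - 1" k] p_pos[of k] p_pos[of "k - 1"] by (auto simp: d_def)
  have d_sum: "(\<Sum>k<Suc n. d k) = p n" for n
    by (induction n) (simp_all add: d_def)
  have pw: "0 < p k * w k" for k
    using p_pos w_pos by simp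
  have N_bounds: "p k * w k \<le> real (N k)" "real (N k) \<le> p k * w k + 1" "1 \<le> N k" for k
    using pw[of k] unfolding N_def by linarith+
  have L_bounds: "d k \<le> real (L k)" "real (L k + N k) \<le> d k + 2 * (p k * w k) + 3" for k
    using d_nonneg[of k] N_bounds[of k] unfolding L_def by linarith+
  have p_lower: "\<forall>\<^sub>F k in sequentially. c / 2 * sqrt (real (Suc k)) \<le> exponent (Suc k)"
    using exponent_lower filterlim_Suc by (rule eventually_compose_filterlim)
  have n_over_p: "(\<lambda>n. real (Suc n) / p n) \<longlonglongrightarrow> 0"
  proof (rule Lim_null_comparison)
    show "\<forall>\<^sub>F n in sequentially. norm (real (Suc n) / p n) \<le> real (Suc n) * exp (- (c / 2) * sqrt (real (Suc n)))"
      using p_lower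
    proof eventually_elim
      case (elim n)
      have "norm (real (Suc n) / p n) = real (Suc n) * exp (- exponent (Suc n))"
        using p_pos[of n] by (simp only: real_norm_def abs_divide abs_of_pos abs_of_nat)
          (simp only: p_def exp_minus divide_inverse)
      also have "\<dots> \<le> real (Suc n) * exp (- (c / 2) * sqrt (real (Suc n)))"
        using elim by (intro mult_left_mono) auto
      finally show ?case .
    qed
    have "(\<lambda>n. real (Suc n) * exp (- D * sqrt (real (Suc n)))) \<longlonglongrightarrow> 0" if "D > 0" for D :: real
      using that by real_asymp
    from this[of "c / 2"] show "(\<lambda>n. real (Suc n) * exp (- (c / 2) * sqrt (real (Suc n)))) \<longlonglongrightarrow> 0"
      using c_pos by simp
  qed
  have p_inf: "(\<lambda>n. p k / p n) \<longlonglongrightarrow> 0" for k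
  proof (rule Lim_null_comparison)
    show "\<forall>\<^sub>F n in sequentially. norm (p k / p n) \<le> p k * (real (Suc n) / p n)"
      using p_pos by (intro always_eventually allI) (simp add: divide_simps less_imp_le)
    show "(\<lambda>n. p k * (real (Suc n) / p n)) \<longlonglongrightarrow> 0"
      using tendsto_mult_left[OF n_over_p, of "p k"] by simp
  qed
  have slack: "(\<lambda>n. \<Sum>k<Suc n. p k / p n * w k) \<longlonglongrightarrow> 0"
  proof -
    let ?a = "\<lambda>k n. if k < Suc n then p k / p n * w k else 0"
    have "summable w"
      unfolding w_def using inverse_squares_sums by (simp add: sums_iff add.commute)
    have "((\<lambda>n. suminf (\<lambda>k. ?a k n)) \<longlonglongrightarrow> suminf (\<lambda>k. 0))"
    proof (rule tannerys_theorem[where M = w, THEN conjunct2, THEN conjunct2])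
      show "(\<lambda>n. ?a k n) \<longlonglongrightarrow> 0" for k
      proof (rule Lim_null_comparison)
        show "\<forall>\<^sub>F n in sequentially. norm (?a k n) \<le> p k / p n * w k"
          using p_pos w_pos by (intro always_eventually allI) (simp add: less_imp_le)
        show "(\<lambda>n. p k / p n * w k) \<longlonglongrightarrow> 0"
          using tendsto_mult_right[OF p_inf[of k], of "w k"] by simp
      qed
      have "norm (?a k n) \<le> w k" for k n
      proof (cases "k < Suc n")
        case True
        then have "p k / p n \<le> 1"
          using p_mono[of k n] p_pos[of n] by simp
        then have "p k / p n * w k \<le> 1 * w k"
          using w_pos[of k] by (intro mult_right_mono) auto
        then show ?thesis
          using True p_pos w_pos[of k] by (simp add: less_imp_le)
      qed (use w_pos[of k] in simp)
      then show "\<forall>\<^sub>F (k, n) in sequentially \<times>\<^sub>F sequentially. norm (?a k n) \<le> w k"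
        by (intro always_eventually) auto
    qed (use \<open>summable w\<close> in auto)
    moreover have "suminf (\<lambda>k. ?a k n) = (\<Sum>k<Suc n. p k / p n * w k)" for n
      by (subst suminf_finite[of "{..<Suc n}"]) auto
    ultimately show ?thesis
      by simp
  qed
  show ?thesis
  proof (rule hausdorff_measure_digit_cantor_set_nonzero)
    show "2 \<le> L k" "1 \<le> N k" for k
      using N_bounds(3)[of k] by (auto simp: L_def)
    \<comment> \<open>Digits at position \<open>Suc k\<close> are eventually at most \<open>7 * p (Suc k) \<le> 7 * exp (c + 1) * p k\<close>, and \<open>H\<close> is what this constant
      contributes to the power.\<close>
    define H where "H = (7 * exp (c + 1)) powr (2 * s)"
    have H: "0 < H"
      by (simp add: H_def)
    have "0 < (1 - 2 * s) * (c / 2)"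
      using s c_pos by simp
    moreover have "\<forall>\<^sub>F k in sequentially. H * (real (Suc k))\<^sup>2 \<le> exp (D * sqrt (real (Suc k)))"
      if "D > 0" for D :: real
      using that H by real_asymp
    ultimately have poly: "\<forall>\<^sub>F k in sequentially.
        H * (real (Suc k))\<^sup>2 \<le> exp ((1 - 2 * s) * (c / 2) * sqrt (real (Suc k)))"
      by blast
    have "\<forall>\<^sub>F k in sequentially. exponent (Suc (Suc k)) \<le> exponent (Suc k) + (c + 1)"
      using exponent_Suc filterlim_Suc by (rule eventually_compose_filterlim)
    with poly p_lower show "\<forall>\<^sub>F k in sequentially. real (L (Suc k) + N (Suc k)) powr (2 * s) \<le> real (N k)"
    proof eventually_elim
      case (elim k)
      have "0 \<le> c / 2 * sqrt (real (Suc k))"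
        using c_pos by simp
      then have "1 \<le> p k"
        using elim(2) by (simp add: p_def)
      then have p1: "1 \<le> p (Suc k)"
        using p_mono[of k "Suc k"] by simp
      have "p (Suc k) * w (Suc k) \<le> p (Suc k) * 1"
        using p_pos w_le by (intro mult_left_mono) (auto simp: less_imp_le)
      then have "real (L (Suc k) + N (Suc k)) \<le> 7 * p (Suc k)"
        using L_bounds(2)[of "Suc k"] d_le[of "Suc k"] p1 by linarith
      also have "p (Suc k) \<le> exp (c + 1) * p k"
        using elim(3) by (simp add: p_def flip: exp_add)
      finally have "real (L (Suc k) + N (Suc k)) \<le> 7 * exp (c + 1) * p k"
        by simp
      then have "real (L (Suc k) + N (Suc k)) powr (2 * s) \<le> (7 * exp (c + 1) * p k) powr (2 * s)"
        using s by (intro powr_mono2) auto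
      also have "\<dots> = H * exp (2 * s * exponent (Suc k))"
      proof -
        have "p k powr (2 * s) = exp (2 * s * exponent (Suc k))"
          by (simp add: p_def powr_def)
        then show ?thesis
          using p_pos[of k] by (simp only: H_def powr_mult)
      qed
      also have "\<dots> \<le> exp ((1 - 2 * s) * exponent (Suc k)) * w k * exp (2 * s * exponent (Suc k))"
      proof (intro mult_right_mono)
        have "H * (real (Suc k))\<^sup>2 \<le> exp ((1 - 2 * s) * (c / 2 * sqrt (real (Suc k))))"
          using elim(1) by (simp add: mult.assoc)
        also have "\<dots> \<le> exp ((1 - 2 * s) * exponent (Suc k))"
          using elim(2) s by (simp add: mult_left_mono)
        finally show "H \<le> exp ((1 - 2 * s) * exponent (Suc k)) * w k"
          by (simp add: w_def pos_le_divide_eq)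
      qed auto
      also have "\<dots> = p k * w k"
        by (simp add: p_def algebra_simps flip: exp_add)
      also have "\<dots> \<le> real (N k)"
        by (rule N_bounds)
      finally show ?case .
    qed
    show "{x \<in> unit_irrationals. \<forall>k. cf_coeff x (Suc k) \<in> {L k..<L k + N k}} \<subseteq> E"
    proof clarify
      fix x
      assume x: "x \<in> unit_irrationals" "\<forall>k. cf_coeff x (Suc k) \<in> {L k..<L k + N k}"
      have digit: "d k \<le> real (cf_coeff x (Suc k))"
        "real (cf_coeff x (Suc k)) \<le> d k + 2 * (p k * w k) + 3" for k
      proof -
        have "L k \<le> cf_coeff x (Suc k)" "cf_coeff x (Suc k) \<le> L k + N k"
          using x(2) by (auto simp: less_imp_le)
        then have "real (L k) \<le> real (cf_coeff x (Suc k))" "real (cf_coeff x (Suc k)) \<le> real (L k + N k)"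
          by (simp_all only: of_nat_le_iff)
        then show "d k \<le> real (cf_coeff x (Suc k))"
          "real (cf_coeff x (Suc k)) \<le> d k + 2 * (p k * w k) + 3"
          using L_bounds[of k] by linarith+
      qed
      have lower: "1 \<le> real (cf_sum x (Suc n)) / p n" for n
      proof -
        have "p n \<le> real (cf_sum x (Suc n))"
          unfolding cf_sum_eq d_sum[symmetric] of_nat_sum by (intro sum_mono digit)
        then show ?thesis
          using p_pos[of n] by simp
      qed
      have upper: "real (cf_sum x (Suc n)) / p n
          \<le> 1 + 2 * (\<Sum>k<Suc n. p k / p n * w k) + 3 * (real (Suc n) / p n)" for n
      proof -
        have "real (cf_sum x (Suc n)) \<le> (\<Sum>k<Suc n. d k + 2 * (p k * w k) + 3)"
          unfolding cf_sum_eq of_nat_sum by (intro sum_mono digit)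
        also have "\<dots> = p n + 2 * (\<Sum>k<Suc n. p k * w k) + 3 * real (Suc n)"
          by (simp only: sum.distrib d_sum flip: sum_distrib_left) simp
        finally have "real (cf_sum x (Suc n)) / p n
            \<le> (p n + 2 * (\<Sum>k<Suc n. p k * w k) + 3 * real (Suc n)) / p n"
          using p_pos[of n] by (intro divide_right_mono) auto
        also have "\<dots> = 1 + 2 * ((\<Sum>k<Suc n. p k * w k) / p n) + 3 * (real (Suc n) / p n)"
          using p_pos[of n] by (simp only: add_divide_distrib times_divide_eq_right) simp
        also have "(\<Sum>k<Suc n. p k * w k) / p n = (\<Sum>k<Suc n. p k / p n * w k)"
          by (simp only: sum_divide_distrib times_divide_eq_left)
        finally show ?thesis .
      qed
      have "(\<lambda>n. real (cf_sum x (Suc n)) / p n) \<longlonglongrightarrow> 1"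
      proof (rule tendsto_sandwich)
        show "\<forall>\<^sub>F n in sequentially. 1 \<le> real (cf_sum x (Suc n)) / p n"
          by (intro always_eventually allI lower)
        show "\<forall>\<^sub>F n in sequentially. real (cf_sum x (Suc n)) / p n
            \<le> 1 + 2 * (\<Sum>k<Suc n. p k / p n * w k) + 3 * (real (Suc n) / p n)"
          by (intro always_eventually allI upper)
        show "(\<lambda>n. 1 + 2 * (\<Sum>k<Suc n. p k / p n * w k) + 3 * (real (Suc n) / p n)) \<longlonglongrightarrow> 1"
          using tendsto_add[OF tendsto_add[OF tendsto_const[of 1] tendsto_mult_left[OF slack, of 2]]
              tendsto_mult_left[OF n_over_p, of 3]] by simp
        show "(\<lambda>n. 1) \<longlonglongrightarrow> (1::real)"
          by simp
      qed
      then have "(\<lambda>n. real (cf_sum x n) / exp (exponent n)) \<longlonglongrightarrow> 1"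
        unfolding p_def by (rule LIMSEQ_imp_Suc)
      with x(1) E show "x \<in> E"
        by blast
    qed
  qed (rule s)
qed

end

section \<open>The dimension\<close>

theorem corollary1p4:
  fixes c :: real and r\<^sub>2 :: "real \<Rightarrow> real" and \<phi> :: "real \<Rightarrow> real"
  assumes c_pos: "0 < c"
    and mono: "mono_on {0<..} (\<lambda>t. c * sqrt t + r\<^sub>2 t)"
    and lim: "(\<lambda>m::nat. Max {\<bar>r\<^sub>2 (real k) - r\<^sub>2 (real (m^2))\<bar> | k::nat. m^2 < k \<and> k \<le> (m + 1)^2})
                \<longlonglongrightarrow> 0"
    and phi: "\<And>t. t > 0 \<Longrightarrow> \<phi> t = exp (c * sqrt t + r\<^sub>2 t)"
  shows "hausdorff_dim (cf_sum_set \<phi>) = 1/2"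
proof -
  define osc where
    "osc m = Max {\<bar>r\<^sub>2 (real k) - r\<^sub>2 (real (m^2))\<bar> | k::nat. m^2 < k \<and> k \<le> (m + 1)^2}" for m
  have osc_bound: "\<bar>r\<^sub>2 (real k) - r\<^sub>2 (real (m\<^sup>2))\<bar> \<le> osc m" if k: "m\<^sup>2 \<le> k" "k \<le> (m + 1)\<^sup>2" for m k
  proof -
    have eq: "{\<bar>r\<^sub>2 (real k) - r\<^sub>2 (real (m^2))\<bar> | k::nat. m^2 < k \<and> k \<le> (m + 1)^2}
        = (\<lambda>k. \<bar>r\<^sub>2 (real k) - r\<^sub>2 (real (m^2))\<bar>) ` {m^2<..(m + 1)^2}"
      by auto
    have le: "\<bar>r\<^sub>2 (real k) - r\<^sub>2 (real (m\<^sup>2))\<bar> \<le> osc m" if "k \<in> {m^2<..(m + 1)^2}" for k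
      unfolding osc_def eq using that by (intro Max_ge) auto
    show ?thesis
    proof (cases "k = m\<^sup>2")
      case True
      have "(m + 1)\<^sup>2 \<in> {m^2<..(m + 1)^2}"
        by (simp add: power2_eq_square)
      from le[OF this] True show ?thesis
        by simp
    next
      case False
      with k show ?thesis
        by (intro le) auto
    qed
  qed
  interpret block_constant_perturbation c "\<lambda>n. r\<^sub>2 (real n)" osc
  proof
    show "c * sqrt (real m) + r\<^sub>2 (real m) \<le> c * sqrt (real n) + r\<^sub>2 (real n)" if "1 \<le> m" "m \<le> n" for m n
      using that by (intro mono_onD[OF mono]) auto
    show "osc \<longlonglongrightarrow> 0"
      unfolding osc_def by (rule lim)
  qed (use c_pos osc_bound in auto)
  have set_eq: "cf_sum_set \<phi>
      = {x \<in> unit_irrationals. (\<lambda>n. real (cf_sum x n) / exp (exponent n)) \<longlonglongrightarrow> 1}"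
  proof -
    have "\<forall>\<^sub>F n in sequentially. real (cf_sum x n) / \<phi> (real n) = real (cf_sum x n) / exp (exponent n)" for x
      using eventually_gt_at_top[of 0] by eventually_elim (simp add: phi exponent_def)
    then show ?thesis
      unfolding cf_sum_set_def by (intro Collect_cong conj_cong refl tendsto_cong) auto
  qed
  have half: "ennreal (1 / 2) = 1 / 2"
    using ennreal_divide_numeral[of 1 "num.Bit0 num.One"] by simp
  show ?thesis
  proof (rule antisym)
    have "hausdorff_dim (cf_sum_set \<phi>) \<le> ennreal (1 / 2) + ennreal e" if "0 < e" for e :: real
    proof -
      have "hausdorff_measure (1 / 2 + e) (cf_sum_set \<phi>) = 0"
        using that by (intro hausdorff_measure_cf_sum_zero) (auto simp: set_eq)
      then have "hausdorff_dim (cf_sum_set \<phi>) \<le> ennreal (1 / 2 + e)"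
        unfolding hausdorff_dim_def using that by (intro Inf_lower CollectI exI[of _ "1 / 2 + e"]) auto
      also have "\<dots> = ennreal (1 / 2) + ennreal e"
        using that by (intro ennreal_plus) auto
      finally show ?thesis .
    qed
    then show "hausdorff_dim (cf_sum_set \<phi>) \<le> 1 / 2"
      unfolding half[symmetric] by (rule ennreal_le_epsilon)
    show "1 / 2 \<le> hausdorff_dim (cf_sum_set \<phi>)"
      unfolding hausdorff_dim_def half[symmetric]
    proof (rule Inf_greatest, clarify)
      fix s :: real
      assume s: "0 \<le> s" "hausdorff_measure s (cf_sum_set \<phi>) = 0"
      then have "\<not> s < 1 / 2"
        using hausdorff_measure_cf_sum_nonzero[of s "cf_sum_set \<phi>"] by (auto simp: set_eq)
      then show "ennreal (1 / 2) \<le> ennreal s"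
        by (intro ennreal_leI) auto
    qed
  qed
qed

end
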